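(* Let $\mathcal{K}$ be a FUR-class with monster model $\mathbb{M}$. Let $a\in\mathbb{M}$ and let $A\subset\mathbb{M}$ be a finite set. Then $\mathrm{Cb}(a/A)\in\mathrm{bcl}(A)$ (bounded closure being taken in $\mathbb{M}^{eq}$).
   Context: SETTING. $(\mathcal{K},\preccurlyeq)$ is an abstract elementary class (AEC) with monster model $\mathbb{M}$: a $\delta$-model homogeneous and $\delta$-universal member of $\mathcal{K}$, $\delta$ a large cardinal. "Bounded" means of size $<\delta$. "Model" means $\mathcal{A}\in\mathcal{K}$, $\mathcal{A}\preccurlyeq\mathbb{M}$; models and parameter sets are bounded unless $\mathbb{M}$ itself is mentioned. $a\in X$ may be a finite tuple; juxtaposition denotes union or concatenation. TYPES. $\mathrm{Aut}(\mathbb{M}/A)$ is the group of automorphisms of $\mathbb{M}$ fixing $A$ pointwise. $a,b$ have the same Galois type over $A$, $t^g(a/A)=t^g(b/A)$, if $f(a)=b$ for some $f\in\mathrm{Aut}(\mathbb{M}/A)$; they have the same weak type, $t(a/A)=t(b/A)$, if $t^g(a/B)=t^g(b/B)$ for all finite $B\subseteq A$ (types of models are types of enumerations). For $A\subseteq B$ with $A$ finite, $t(a/B)$ splits over $A$ if there are $b,c\in B$ with $t(b/A)=t(c/A)$ but $t(ab/A)\ne t(ac/A)$. $a\downarrow^{ns}_B C$ means that $t(a/B\cup C)$ does not split over some finite $A\subseteq B$; $A\downarrow^{ns}_B C$ means $a\downarrow^{ns}_BC$ for each $a\in A$. $a\in\mathrm{bcl}(A)$ iff $t(a/A)$ has only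 boundedly many realizations. FUR-CLASS. $\mathcal{K}$ is a FUR-class if it has AP and JEP, $LS(\mathcal{K})=\omega$, has arbitrarily large structures, contains no finite models, and satisfies: (AI) Every countable model $\mathcal{A}$ is s-saturated: for any $b\in\mathbb{M}$ and finite $A\subseteq\mathcal{A}$ there is $a\in\mathcal{A}$ with $t(a/A)=t(b/A)$. (AII) For all $a$ and countable $\mathcal{A}$ there is an s-primary model $\mathcal{B}=\mathcal{A}a\cup\bigcup_{i<\omega}a_i$ over $\mathcal{A}a$. [s-primary: the $a_i$ are singletons and for all $n<\omega$ there is a finite $A_n\subset\mathcal{A}$ such that for all $(a',a_0',\dots,a_n')$ with $t(a'/\mathcal{A})=t(a/\mathcal{A})$: $t(a',a_0',\dots,a_n'/A_n)=t(a,a_0,\dots,a_n/A_n)$ implies $t(a',a_0',\dots,a_n'/\mathcal{A})=t(a,a_0,\dots,a_n/\mathcal{A})$.] (AIII) Let $\mathcal{A},\mathcal{B},\mathcal{C}$ be models with $\mathcal{A}\downarrow^{ns}_{\mathcal{B}}\mathcal{C}$ and $\mathcal{B}=\mathcal{A}\cap\mathcal{C}$. Then there is a unique (not only up to isomorphism) s-prime model $\mathcal{D}$ over $\mathcal{A}\cup\mathcal{C}$; furthermore, if $\mathcal{C}\subseteq\mathcal{C}'$ and $\mathcal{A}\downarrow^{ns}_{\mathcal{B}}\mathcal{C}'$, then $\mathcal{D}\downarrow^{ns}_{\mathcal{C}}\mathcal{C}'$. [For models $\mathcal{A}_i$, $i<\alpha$, and $A=\bigcup_{i<\alpha}\mathcal{A}_i$,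 a map $f:A\to\mathbb{M}$ is weakly elementary w.r.t. $(\mathcal{A}_i)_{i<\alpha}$ if $t(a/\emptyset)=t(f(a)/\emptyset)$ for all $a\in A$ and $f(\mathcal{A}_i)\preccurlyeq\mathbb{M}$ for all $i$. A model $\mathcal{D}$ is s-prime over $A$ if for every model $\mathcal{B}$ and every $f:A\to\mathcal{B}$ weakly elementary w.r.t. $(\mathcal{A}_i)_{i<\alpha}$ there is an elementary embedding $g:\mathcal{D}\to\mathcal{B}$ with $f\subseteq g$.] (AIV) For each $a\in\mathbb{M}$ there is $n<\omega$ such that for every countable model $\mathcal{A}$ and finite $A\subset\mathcal{A}$, player II has a winning strategy in $GI(a,A,\mathcal{A})$ in $n$ moves. [$GI(a,A,\mathcal{A})$: start with $a_0=a$, $A_0=A$. At move $n$, player I chooses $a_{n+1}\in\mathbb{M}$ and a finite $A_{n+1}'\subseteq\mathcal{A}$ with $t(a_{n+1}/A_n)=t(a_n/A_n)$, $A_n\subseteq A'_{n+1}$ and $t(a_{n+1}/A'_{n+1})\ne t(a_n/A'_{n+1})$; then player II chooses a finite $A_{n+1}\subseteq\mathcal{A}$ with $A'_{n+1}\subseteq A_{n+1}$. Player II wins if player I can no longer move.] (AV) If $\mathcal{A}\subseteq\mathcal{B}$ are countable models, $a\in\mathbb{M}$ and $\mathcal{B}\downarrow^{ns}_{\mathcal{A}}a$, then $a\downarrow^{ns}_{\mathcal{A}}\mathcal{B}$. (AVI) For all models $\mathcal{A},\mathcal{B},\mathcal{D}$ with $\mathcal{A}\subseteq\mathcal{B}\cap\mathcal{D}$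 there is a model $\mathcal{C}$ with $t(\mathcal{C}/\mathcal{A})=t(\mathcal{B}/\mathcal{A})$ and $\mathcal{C}\downarrow^{ns}_{\mathcal{A}}\mathcal{D}$. INDEPENDENCE. For finite $A$, $E(A)$ is the set of $\mathrm{Aut}(\mathbb{M}/A)$-invariant equivalence relations on powers $\mathbb{M}^n$ with boundedly many classes; $Lt(a/B)=Lt(b/B)$ means $(a,b)\in E$ for all finite $A\subseteq B$ and $E\in E(A)$. For $A\subseteq B$, $A$ finite, $t(a/B)$ Lascar splits over $A$ if there are $b,c\in B$ with $Lt(b/A)=Lt(c/A)$ and $t(ab/A)\neq t(ac/A)$. $a\downarrow_B C$ means: there is a finite $A\subseteq B$ such that for all $D\supseteq B\cup C$ there is $b$ with $t(b/B\cup C)=t(a/B\cup C)$ and $t(b/D)$ not Lascar splitting over $A$. IMAGINARIES. $\mathcal{E}$ is a countable collection of $\emptyset$-invariant equivalence relations $E\subseteq\mathbb{M}^n\times\mathbb{M}^n$ (various $n$), containing equality, each given by a countable collection $G_E$ of Galois types via $(a,b)\in E$ iff $t^g(ab/\emptyset)\in G_E$. $\mathbb{M}^{eq}=\{a/E:a\in\mathbb{M},E\in\mathcal{E}\}$, with $a$ identified with $a/{=}$, the structure of $\mathbb{M}$ on $P_=$, and predicates $P_E$ for $\{a/E:a\in\mathbb{M}\}$ and functions $F_E(a)=a/E$. All notions above also apply in $\mathbb{M}^{eq}$, with models $\mathcal{A}^{eq}=\{a/E:a\in\mathcal{A},E\in\mathcal{E}\}$. GLOBAL TYPES. The supermonster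 $\mathbb{M}'\in\mathcal{K}$ is a $|\mathbb{M}'|$-model homogeneous and universal structure with $\mathbb{M}\preccurlyeq\mathbb{M}'$ and $|\mathbb{M}'|>|\mathbb{M}|$. Types, Lascar types and independence for elements of $\mathbb{M}'$ are computed in $\mathbb{M}'$. A global type $p$ is a maximal collection $\{p_A:A\subset\mathbb{M}\text{ finite}\}$ such that $p_A$ is a Galois type over $A$, whenever $A\subseteq B$ and $b\in\mathbb{M}$ realizes $p_B$ then $b$ realizes $p_A$, and some single $b\in\mathbb{M}'$ realizes $p_A$ for every finite $A\subset\mathbb{M}$. For $f\in\mathrm{Aut}(\mathbb{M}^{eq})$, $f(p)=p$ means: for all finite $A,B\subset\mathbb{M}$ with $f(B)=A$ and all $b$ realizing $p_B$, $f(b)$ realizes $p_A$. $\alpha\in\mathbb{M}^{eq}$ is a canonical base for $p$ if for every $f\in\mathrm{Aut}(\mathbb{M}^{eq})$: $f(p)=p$ iff $f(\alpha)=\alpha$. For $a\in\mathbb{M}$ and $A\subset\mathbb{M}$, there is $b\in\mathbb{M}'$ with $Lt(b/A)=Lt(a/A)$ and $b\downarrow_A\mathbb{M}$; a canonical base for $a$ over $A$, written $\alpha=\mathrm{Cb}(a/A)$, is a canonical base of $t(b/\mathbb{M})$. STANDING CHOICE OF $\mathcal{E}$ (ensuring canonical bases exist in $\mathbb{M}^{eq}$). For a global type $p$ realized by $b\in\mathbb{M}'$ with $t(b/\mathbb{M})$ not splitting over a finite tuple $a\in\mathbb{M}$: for $c\in\mathbb{M}$ let $q_c=t(bc/\emptyset)$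 and let $q_i^c$, $i<\omega$, be types over $\emptyset$ such that for all $d\in\mathbb{M}$, $bd$ realizes $q_c$ iff $ad$ realizes some $q_i^c$. Let $(a_0,a_1)\in E$ iff for all $c,d\in\mathbb{M}$: $a_0d$ realizes some $q_i^c$ iff $a_1d$ realizes some $q_i^c$. These $E$ depend only on $t(ba/\emptyset)$; $\mathcal{E}$ contains all of them. *)

theory Defs
  imports Main "HOL-Library.Countable_Set"
begin

unbundle cardinal_syntax

text \<open>
  Everything lives inside one type \<open>'u\<close>, which plays the part of the set-theoretic universe: a class
  of structures is a set of structures with universe in \<open>'u\<close>, closed under isomorphism inside
  \<open>'u\<close>.  Since \<open>'u\<close> is a type variable, this covers every size.  Finite tuples are lists, a tuple in
  \<open>X\<close> is an element of \<^term>\<open>lists X\<close>, and concatenation of tuples is \<open>@\<close>.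
\<close>

definition tuples :: "'u set \<Rightarrow> nat \<Rightarrow> 'u list set" where
  "tuples X n = {xs \<in> lists X. length xs = n}"


section \<open>Structures and abstract elementary classes\<close>

record ('f, 'r) vocab =
  fsyms :: "'f set"
  rsyms :: "'r set"
  farity :: "'f \<Rightarrow> nat"
  rarity :: "'r \<Rightarrow> nat"

record ('u, 'f, 'r) lstruct =
  univ :: "'u set"
  fun_of :: "'f \<Rightarrow> 'u list \<Rightarrow> 'u"
  rel_of :: "'r \<Rightarrow> 'u list set"

text \<open>The values of the interpretation off the universe and off the vocabulary are normalised, so
  that two structures with the same universe and the same interpretations are equal.\<close>

definition is_struct :: "('f, 'r) vocab \<Rightarrow> ('u, 'f, 'r) lstruct \<Rightarrow> bool" where
  "is_struct \<tau> A \<longleftrightarrow>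
     (\<forall>s xs. if s \<in> fsyms \<tau> \<and> xs \<in> tuples (univ A) (farity \<tau> s)
             then fun_of A s xs \<in> univ A else fun_of A s xs = undefined) \<and>
     (\<forall>s. rel_of A s \<subseteq> (if s \<in> rsyms \<tau> then tuples (univ A) (rarity \<tau> s) else {}))"

definition substruct :: "('f, 'r) vocab \<Rightarrow> ('u, 'f, 'r) lstruct \<Rightarrow> ('u, 'f, 'r) lstruct \<Rightarrow> bool" where
  "substruct \<tau> A B \<longleftrightarrow> univ A \<subseteq> univ B \<and>
     (\<forall>s\<in>fsyms \<tau>. \<forall>xs\<in>tuples (univ A) (farity \<tau> s). fun_of A s xs = fun_of B s xs) \<and>
     (\<forall>s\<in>rsyms \<tau>. \<forall>xs\<in>tuples (univ A) (rarity \<tau> s). xs \<in> rel_of A s \<longleftrightarrow> xs \<in> rel_of B s)"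

definition induced :: "('f, 'r) vocab \<Rightarrow> ('u, 'f, 'r) lstruct \<Rightarrow> 'u set \<Rightarrow> ('u, 'f, 'r) lstruct" where
  "induced \<tau> A X =
     \<lparr>univ = X,
      fun_of = (\<lambda>s xs. if s \<in> fsyms \<tau> \<and> xs \<in> tuples X (farity \<tau> s)
                       then fun_of A s xs else undefined),
      rel_of = (\<lambda>s. if s \<in> rsyms \<tau> then rel_of A s \<inter> tuples X (rarity \<tau> s) else {})\<rparr>"

definition iso ::
  "('f, 'r) vocab \<Rightarrow> ('u \<Rightarrow> 'v) \<Rightarrow> ('u, 'f, 'r) lstruct \<Rightarrow> ('v, 'f, 'r) lstruct \<Rightarrow> bool" where
  "iso \<tau> h A B \<longleftrightarrow> bij_betw h (univ A) (univ B) \<and>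
     (\<forall>s\<in>fsyms \<tau>. \<forall>xs\<in>tuples (univ A) (farity \<tau> s). h (fun_of A s xs) = fun_of B s (map h xs)) \<and>
     (\<forall>s\<in>rsyms \<tau>. \<forall>xs\<in>tuples (univ A) (rarity \<tau> s). xs \<in> rel_of A s \<longleftrightarrow> map h xs \<in> rel_of B s)"

text \<open>Only the values of an automorphism on the universe matter.\<close>

definition Aut :: "('f, 'r) vocab \<Rightarrow> ('u, 'f, 'r) lstruct \<Rightarrow> ('u \<Rightarrow> 'u) set" where
  "Aut \<tau> A = {f. iso \<tau> f A A}"

definition AutOver :: "('f, 'r) vocab \<Rightarrow> ('u, 'f, 'r) lstruct \<Rightarrow> 'u set \<Rightarrow> ('u \<Rightarrow> 'u) set" where
  "AutOver \<tau> A X = {f \<in> Aut \<tau> A. \<forall>x\<in>X. f x = x}"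

text \<open>For a chain \<open>C\<close> of structures this determines \<open>U\<close>, because symbols have finite arity.\<close>

definition is_union ::
  "('f, 'r) vocab \<Rightarrow> ('u, 'f, 'r) lstruct set \<Rightarrow> ('u, 'f, 'r) lstruct \<Rightarrow> bool" where
  "is_union \<tau> C U \<longleftrightarrow>
     is_struct \<tau> U \<and> univ U = (\<Union>A\<in>C. univ A) \<and> (\<forall>A\<in>C. substruct \<tau> A U)"

text \<open>\<open>\<kappa>\<close> satisfies the Loewenheim-Skolem axiom (with the usual convention
  \<open>LS(K) \<ge> |\<tau>| + \<omega>\<close>).\<close>

definition ls_bound ::
  "('f, 'r) vocab \<Rightarrow> (('u, 'f, 'r) lstruct \<Rightarrow> ('u, 'f, 'r) lstruct \<Rightarrow> bool) \<Rightarrow>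
   ('u, 'f, 'r) lstruct set \<Rightarrow> 'c rel \<Rightarrow> bool" where
  "ls_bound \<tau> le K \<kappa> \<longleftrightarrow>
     Card_order \<kappa> \<and> natLeq \<le>o \<kappa> \<and> |fsyms \<tau> <+> rsyms \<tau>| \<le>o \<kappa> \<and>
     (\<forall>A\<in>K. \<forall>X\<subseteq>univ A. \<exists>B. le B A \<and> X \<subseteq> univ B \<and> |univ B| \<le>o |X| +c \<kappa>)"

definition ls_number ::
  "('f, 'r) vocab \<Rightarrow> (('u, 'f, 'r) lstruct \<Rightarrow> ('u, 'f, 'r) lstruct \<Rightarrow> bool) \<Rightarrow>
   ('u, 'f, 'r) lstruct set \<Rightarrow> 'c rel \<Rightarrow> bool" where
  "ls_number \<tau> le K \<kappa> \<longleftrightarrow>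
     ls_bound \<tau> le K \<kappa> \<and> (\<forall>\<mu> :: 'c rel. ls_bound \<tau> le K \<mu> \<longrightarrow> \<kappa> \<le>o \<mu>)"

definition elem_emb ::
  "('f, 'r) vocab \<Rightarrow> (('u, 'f, 'r) lstruct \<Rightarrow> ('u, 'f, 'r) lstruct \<Rightarrow> bool) \<Rightarrow>
   ('u \<Rightarrow> 'u) \<Rightarrow> ('u, 'f, 'r) lstruct \<Rightarrow> ('u, 'f, 'r) lstruct \<Rightarrow> bool" where
  "elem_emb \<tau> le g A B \<longleftrightarrow> (\<exists>A'. is_struct \<tau> A' \<and> iso \<tau> g A A' \<and> le A' B)"

locale aec =
  fixes \<tau> :: "('f, 'r) vocab"
    and le :: "('u, 'f, 'r) lstruct \<Rightarrow> ('u, 'f, 'r) lstruct \<Rightarrow> bool"  (infix "\<preceq>" 50)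
    and K :: "('u, 'f, 'r) lstruct set"
  assumes structs: "A \<in> K \<Longrightarrow> is_struct \<tau> A"
    and iso_closed: "\<lbrakk>A \<in> K; is_struct \<tau> B; iso \<tau> h A B\<rbrakk> \<Longrightarrow> B \<in> K"
    and iso_closed_le: "\<lbrakk>A \<preceq> B; is_struct \<tau> A'; is_struct \<tau> B'; iso \<tau> h A A'; iso \<tau> h B B'\<rbrakk> \<Longrightarrow> A' \<preceq> B'"
    and le_in: "A \<preceq> B \<Longrightarrow> A \<in> K \<and> B \<in> K"
    and le_substruct: "A \<preceq> B \<Longrightarrow> substruct \<tau> A B"
    and le_refl: "A \<in> K \<Longrightarrow> A \<preceq> A"
    and le_trans: "\<lbrakk>A \<preceq> B; B \<preceq> D\<rbrakk> \<Longrightarrow> A \<preceq> D"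
    and chain_union:
      "\<lbrakk>C \<noteq> {}; C \<subseteq> K; \<forall>A\<in>C. \<forall>B\<in>C. A \<preceq> B \<or> B \<preceq> A; is_union \<tau> C U\<rbrakk>
       \<Longrightarrow> U \<in> K \<and> (\<forall>A\<in>C. A \<preceq> U) \<and> (\<forall>D\<in>K. (\<forall>A\<in>C. A \<preceq> D) \<longrightarrow> U \<preceq> D)"
    and coherence: "\<lbrakk>A \<preceq> D; B \<preceq> D; univ A \<subseteq> univ B\<rbrakk> \<Longrightarrow> A \<preceq> B"
    and loewenheim_skolem: "\<exists>\<kappa> :: ('f + 'r + 'u) rel. ls_bound \<tau> le K \<kappa>"

definition amalgamation ::
  "('f, 'r) vocab \<Rightarrow> (('u, 'f, 'r) lstruct \<Rightarrow> ('u, 'f, 'r) lstruct \<Rightarrow> bool) \<Rightarrow>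
   ('u, 'f, 'r) lstruct set \<Rightarrow> bool" where
  "amalgamation \<tau> le K \<longleftrightarrow>
     (\<forall>A B C. le A B \<and> le A C \<longrightarrow>
        (\<exists>D\<in>K. \<exists>g h. elem_emb \<tau> le g B D \<and> elem_emb \<tau> le h C D \<and> (\<forall>x\<in>univ A. g x = h x)))"

definition joint_embedding ::
  "('f, 'r) vocab \<Rightarrow> (('u, 'f, 'r) lstruct \<Rightarrow> ('u, 'f, 'r) lstruct \<Rightarrow> bool) \<Rightarrow>
   ('u, 'f, 'r) lstruct set \<Rightarrow> bool" where
  "joint_embedding \<tau> le K \<longleftrightarrow>
     (\<forall>A\<in>K. \<forall>B\<in>K. \<exists>D\<in>K. (\<exists>g. elem_emb \<tau> le g A D) \<and> (\<exists>h. elem_emb \<tau> le h B D))"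

text \<open>\<open>\<kappa>\<close>-model homogeneous and \<open>\<kappa>\<close>-universal members of \<open>K\<close>.\<close>

definition monster ::
  "('f, 'r) vocab \<Rightarrow> (('u, 'f, 'r) lstruct \<Rightarrow> ('u, 'f, 'r) lstruct \<Rightarrow> bool) \<Rightarrow>
   ('u, 'f, 'r) lstruct set \<Rightarrow> 'c rel \<Rightarrow> ('u, 'f, 'r) lstruct \<Rightarrow> bool" where
  "monster \<tau> le K \<kappa> M \<longleftrightarrow> M \<in> K \<and>
     (\<forall>A B f. le A M \<and> le B M \<and> |univ A| <o \<kappa> \<and> |univ B| <o \<kappa> \<and> iso \<tau> f A B \<longrightarrow>
        (\<exists>g\<in>Aut \<tau> M. \<forall>x\<in>univ A. g x = f x)) \<and>
     (\<forall>A\<in>K. |univ A| <o \<kappa> \<longrightarrow> (\<exists>g. elem_emb \<tau> le g A M))"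

definition inaccessible :: "'c rel \<Rightarrow> bool" where
  "inaccessible \<delta> \<longleftrightarrow> Card_order \<delta> \<and> natLeq <o \<delta> \<and> regularCard \<delta> \<and>
     (\<forall>X\<subseteq>Field \<delta>. |X| <o \<delta> \<longrightarrow> |Pow X| <o \<delta>)"


section \<open>Types\<close>

text \<open>Here and below \<open>N\<close> is the structure in which types are computed: \<open>\<bbbM>\<close>, \<open>\<bbbM>'\<close> or
  \<open>\<bbbM>\<^sup>e\<^sup>q\<close>.  A Galois type is the set of its realizations in \<open>N\<close>.\<close>

definition same_gtp ::
  "('f, 'r) vocab \<Rightarrow> ('u, 'f, 'r) lstruct \<Rightarrow> 'u set \<Rightarrow> 'u list \<Rightarrow> 'u list \<Rightarrow> bool" where
  "same_gtp \<tau> N A a b \<longleftrightarrow> (\<exists>f\<in>AutOver \<tau> N A. map f a = b)"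

definition gtp :: "('f, 'r) vocab \<Rightarrow> ('u, 'f, 'r) lstruct \<Rightarrow> 'u set \<Rightarrow> 'u list \<Rightarrow> 'u list set" where
  "gtp \<tau> N A a = {b \<in> lists (univ N). same_gtp \<tau> N A a b}"

definition same_tp ::
  "('f, 'r) vocab \<Rightarrow> ('u, 'f, 'r) lstruct \<Rightarrow> 'u set \<Rightarrow> 'u list \<Rightarrow> 'u list \<Rightarrow> bool" where
  "same_tp \<tau> N A a b \<longleftrightarrow> (\<forall>B\<subseteq>A. finite B \<longrightarrow> same_gtp \<tau> N B a b)"

text \<open>\<open>t(Y/A) = t(X/A)\<close> for possibly infinite \<open>X\<close>, \<open>Y\<close>: for some enumeration of \<open>X\<close> and the
  enumeration of \<open>Y\<close> obtained from it through \<open>h\<close>, the types over \<open>A\<close> agree.\<close>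

definition same_tp_set ::
  "('f, 'r) vocab \<Rightarrow> ('u, 'f, 'r) lstruct \<Rightarrow> 'u set \<Rightarrow> 'u set \<Rightarrow> 'u set \<Rightarrow> bool" where
  "same_tp_set \<tau> N A X Y \<longleftrightarrow>
     (\<exists>h. h ` X = Y \<and> (\<forall>B\<subseteq>A. finite B \<longrightarrow> (\<exists>f\<in>AutOver \<tau> N B. \<forall>x\<in>X. f x = h x)))"

text \<open>\<open>t(a/B)\<close> splits over \<open>A\<close>.\<close>

definition splits ::
  "('f, 'r) vocab \<Rightarrow> ('u, 'f, 'r) lstruct \<Rightarrow> 'u list \<Rightarrow> 'u set \<Rightarrow> 'u set \<Rightarrow> bool" where
  "splits \<tau> N a B A \<longleftrightarrow>
     (\<exists>b\<in>lists B. \<exists>c\<in>lists B. same_tp \<tau> N A b c \<and> \<not> same_tp \<tau> N A (a @ b) (a @ c))"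

definition indep_ns ::
  "('f, 'r) vocab \<Rightarrow> ('u, 'f, 'r) lstruct \<Rightarrow> 'u list \<Rightarrow> 'u set \<Rightarrow> 'u set \<Rightarrow> bool" where
  "indep_ns \<tau> N a B C \<longleftrightarrow> (\<exists>A\<subseteq>B. finite A \<and> \<not> splits \<tau> N a (B \<union> C) A)"

definition set_indep_ns ::
  "('f, 'r) vocab \<Rightarrow> ('u, 'f, 'r) lstruct \<Rightarrow> 'u set \<Rightarrow> 'u set \<Rightarrow> 'u set \<Rightarrow> bool" where
  "set_indep_ns \<tau> N A B C \<longleftrightarrow> (\<forall>a\<in>lists A. indep_ns \<tau> N a B C)"

definition bcl ::
  "('f, 'r) vocab \<Rightarrow> 'c rel \<Rightarrow> ('u, 'f, 'r) lstruct \<Rightarrow> 'u set \<Rightarrow> 'u list set" where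
  "bcl \<tau> \<delta> N A = {a \<in> lists (univ N). |{b \<in> lists (univ N). same_tp \<tau> N A b a}| <o \<delta>}"


section \<open>FUR-classes\<close>

text \<open>Bounded models \<open>\<A> \<preceq> \<bbbM>\<close>, given by their universes.\<close>

definition is_model ::
  "('f, 'r) vocab \<Rightarrow> (('u, 'f, 'r) lstruct \<Rightarrow> ('u, 'f, 'r) lstruct \<Rightarrow> bool) \<Rightarrow>
   'c rel \<Rightarrow> ('u, 'f, 'r) lstruct \<Rightarrow> 'u set \<Rightarrow> bool" where
  "is_model \<tau> le \<delta> M X \<longleftrightarrow> X \<subseteq> univ M \<and> le (induced \<tau> M X) M \<and> |X| <o \<delta>"

definition s_saturated :: "('f, 'r) vocab \<Rightarrow> ('u, 'f, 'r) lstruct \<Rightarrow> 'u set \<Rightarrow> bool" where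
  "s_saturated \<tau> M X \<longleftrightarrow>
     (\<forall>b\<in>lists (univ M). \<forall>A\<subseteq>X. finite A \<longrightarrow> (\<exists>a\<in>lists X. same_tp \<tau> M A a b))"

text \<open>\<open>s\<close> witnesses that \<open>X \<union> a \<union> {s 0, s 1, \<dots>}\<close> is s-primary over \<open>Xa\<close>.\<close>

definition s_primary ::
  "('f, 'r) vocab \<Rightarrow> (('u, 'f, 'r) lstruct \<Rightarrow> ('u, 'f, 'r) lstruct \<Rightarrow> bool) \<Rightarrow>
   'c rel \<Rightarrow> ('u, 'f, 'r) lstruct \<Rightarrow> 'u set \<Rightarrow> 'u list \<Rightarrow> (nat \<Rightarrow> 'u) \<Rightarrow> bool" where
  "s_primary \<tau> le \<delta> M X a s \<longleftrightarrow>
     is_model \<tau> le \<delta> M (X \<union> set a \<union> range s) \<and>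
     (\<forall>n. \<exists>A\<subseteq>X. finite A \<and>
        (\<forall>a'\<in>lists (univ M). \<forall>s'\<in>tuples (univ M) (Suc n).
           same_tp \<tau> M X a' a \<and> same_tp \<tau> M A (a' @ s') (a @ map s [0..<Suc n]) \<longrightarrow>
           same_tp \<tau> M X (a' @ s') (a @ map s [0..<Suc n])))"

text \<open>\<open>F\<close> is the set of models \<open>\<A>\<^sub>i\<close> whose union is the domain of \<open>f\<close>.\<close>

definition weakly_elementary ::
  "('f, 'r) vocab \<Rightarrow> (('u, 'f, 'r) lstruct \<Rightarrow> ('u, 'f, 'r) lstruct \<Rightarrow> bool) \<Rightarrow>
   'c rel \<Rightarrow> ('u, 'f, 'r) lstruct \<Rightarrow> 'u set set \<Rightarrow> ('u \<Rightarrow> 'u) \<Rightarrow> bool" where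
  "weakly_elementary \<tau> le \<delta> M F f \<longleftrightarrow>
     (\<forall>a\<in>lists (\<Union>F). same_tp \<tau> M {} a (map f a)) \<and> (\<forall>X\<in>F. is_model \<tau> le \<delta> M (f ` X))"

definition s_prime ::
  "('f, 'r) vocab \<Rightarrow> (('u, 'f, 'r) lstruct \<Rightarrow> ('u, 'f, 'r) lstruct \<Rightarrow> bool) \<Rightarrow>
   'c rel \<Rightarrow> ('u, 'f, 'r) lstruct \<Rightarrow> 'u set set \<Rightarrow> 'u set \<Rightarrow> bool" where
  "s_prime \<tau> le \<delta> M F D \<longleftrightarrow>
     is_model \<tau> le \<delta> M D \<and> \<Union>F \<subseteq> D \<and>
     (\<forall>B f. is_model \<tau> le \<delta> M B \<and> f ` (\<Union>F) \<subseteq> B \<and> weakly_elementary \<tau> le \<delta> M F f \<longrightarrow>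
        (\<exists>g. elem_emb \<tau> le g (induced \<tau> M D) (induced \<tau> M B) \<and> (\<forall>x\<in>\<Union>F. g x = f x)))"

text \<open>The game \<open>GI(a, A, X)\<close>.  A position is a pair of the current tuple and the current finite
  subset of \<open>X\<close>; a strategy \<open>\<sigma>\<close> of player II answers the list of all moves made by player I,
  most recent move first.\<close>

definition gi_move ::
  "('f, 'r) vocab \<Rightarrow> ('u, 'f, 'r) lstruct \<Rightarrow> 'u set \<Rightarrow> 'u list \<times> 'u set \<Rightarrow> 'u list \<times> 'u set \<Rightarrow> bool"
where
  "gi_move \<tau> M X = (\<lambda>(a, A) (a', A').
     a' \<in> lists (univ M) \<and> finite A' \<and> A \<subseteq> A' \<and> A' \<subseteq> X \<and>
     same_tp \<tau> M A a' a \<and> \<not> same_tp \<tau> M A' a' a)"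

inductive gi_play ::
  "('f, 'r) vocab \<Rightarrow> ('u, 'f, 'r) lstruct \<Rightarrow> 'u set \<Rightarrow> (('u list \<times> 'u set) list \<Rightarrow> 'u set) \<Rightarrow>
   'u list \<times> 'u set \<Rightarrow> ('u list \<times> 'u set) list \<Rightarrow> 'u list \<times> 'u set \<Rightarrow> bool"
  for \<tau> M X \<sigma> start where
  "gi_play \<tau> M X \<sigma> start [] start"
| "\<lbrakk>gi_play \<tau> M X \<sigma> start ms pos; gi_move \<tau> M X pos (a', A')\<rbrakk>
   \<Longrightarrow> gi_play \<tau> M X \<sigma> start ((a', A') # ms) (a', \<sigma> ((a', A') # ms))"

text \<open>Against the strategy player I makes at most \<open>n\<close> moves.\<close>

definition gi_wins ::
  "('f, 'r) vocab \<Rightarrow> ('u, 'f, 'r) lstruct \<Rightarrow> 'u set \<Rightarrow> nat \<Rightarrow> 'u list \<Rightarrow> 'u set \<Rightarrow> bool" where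
  "gi_wins \<tau> M X n a A \<longleftrightarrow>
     (\<exists>\<sigma>. \<forall>ms pos. gi_play \<tau> M X \<sigma> (a, A) ms pos \<longrightarrow>
        length ms \<le> n \<and>
        (\<forall>a' A'. gi_move \<tau> M X pos (a', A') \<longrightarrow>
           finite (\<sigma> ((a', A') # ms)) \<and> A' \<subseteq> \<sigma> ((a', A') # ms) \<and> \<sigma> ((a', A') # ms) \<subseteq> X))"

text \<open>In \<open>arbitrarily_large\<close> the cardinals in question are those of the universe \<open>'u\<close>.\<close>

locale fur_class = aec \<tau> le K
  for \<tau> :: "('f, 'r) vocab"
    and le :: "('u, 'f, 'r) lstruct \<Rightarrow> ('u, 'f, 'r) lstruct \<Rightarrow> bool"  (infix "\<preceq>" 50)
    and K :: "('u, 'f, 'r) lstruct set" +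
  fixes \<delta> :: "'c rel"
    and M :: "('u, 'f, 'r) lstruct"
  assumes large_cardinal: "inaccessible \<delta>"
    and monster_model: "monster \<tau> le K \<delta> M"
    and AP: "amalgamation \<tau> le K"
    and JEP: "joint_embedding \<tau> le K"
    and LS_omega: "ls_number \<tau> le K natLeq"
    and arbitrarily_large: "\<forall>X :: 'u set. \<exists>A\<in>K. |X| \<le>o |univ A|"
    and no_finite_models: "\<forall>A\<in>K. infinite (univ A)"
    and AI: "\<forall>X. is_model \<tau> le \<delta> M X \<and> countable X \<longrightarrow> s_saturated \<tau> M X"
    and AII: "\<forall>a\<in>lists (univ M). \<forall>X. is_model \<tau> le \<delta> M X \<and> countable X \<longrightarrow>
                (\<exists>s. s_primary \<tau> le \<delta> M X a s)"
    and AIII: "\<forall>A B C. is_model \<tau> le \<delta> M A \<and> is_model \<tau> le \<delta> M B \<and> is_model \<tau> le \<delta> M C \<and>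
                 set_indep_ns \<tau> M A B C \<and> B = A \<inter> C \<longrightarrow>
                 (\<exists>D. s_prime \<tau> le \<delta> M {A, C} D \<and>
                      (\<forall>D'. s_prime \<tau> le \<delta> M {A, C} D' \<longrightarrow> D' = D) \<and>
                      (\<forall>C'. is_model \<tau> le \<delta> M C' \<and> C \<subseteq> C' \<and> set_indep_ns \<tau> M A B C' \<longrightarrow>
                            set_indep_ns \<tau> M D C C'))"
    and AIV: "\<forall>a\<in>lists (univ M). \<exists>n. \<forall>X A. is_model \<tau> le \<delta> M X \<and> countable X \<and>
                 A \<subseteq> X \<and> finite A \<longrightarrow> gi_wins \<tau> M X n a A"
    and AV: "\<forall>A B. \<forall>a\<in>lists (univ M). is_model \<tau> le \<delta> M A \<and> countable A \<and>
               is_model \<tau> le \<delta> M B \<and> countable B \<and> A \<subseteq> B \<and> set_indep_ns \<tau> M B A (set a) \<longrightarrow>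
               indep_ns \<tau> M a A B"
    and AVI: "\<forall>A B D. is_model \<tau> le \<delta> M A \<and> is_model \<tau> le \<delta> M B \<and> is_model \<tau> le \<delta> M D \<and>
                A \<subseteq> B \<inter> D \<longrightarrow>
                (\<exists>C. is_model \<tau> le \<delta> M C \<and> same_tp_set \<tau> M A B C \<and> set_indep_ns \<tau> M C A D)"


section \<open>Lascar types and independence\<close>

text \<open>The members of \<open>E(A)\<close> on \<open>N\<^sup>n\<close>.\<close>

definition lascar_rels ::
  "('f, 'r) vocab \<Rightarrow> 'c rel \<Rightarrow> ('u, 'f, 'r) lstruct \<Rightarrow> 'u set \<Rightarrow> nat \<Rightarrow> ('u list \<times> 'u list) set set"
where
  "lascar_rels \<tau> \<delta> N A n = {E. equiv (tuples (univ N) n) E \<and>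
     (\<forall>f\<in>AutOver \<tau> N A. \<forall>(a, b)\<in>E. (map f a, map f b) \<in> E) \<and>
     |tuples (univ N) n // E| <o \<delta>}"

definition same_Lt ::
  "('f, 'r) vocab \<Rightarrow> 'c rel \<Rightarrow> ('u, 'f, 'r) lstruct \<Rightarrow> 'u set \<Rightarrow> 'u list \<Rightarrow> 'u list \<Rightarrow> bool" where
  "same_Lt \<tau> \<delta> N B a b \<longleftrightarrow> length a = length b \<and>
     (\<forall>A\<subseteq>B. finite A \<longrightarrow> (\<forall>E\<in>lascar_rels \<tau> \<delta> N A (length a). (a, b) \<in> E))"

text \<open>\<open>t(a/B)\<close> Lascar splits over \<open>A\<close>.\<close>

definition lascar_splits ::
  "('f, 'r) vocab \<Rightarrow> 'c rel \<Rightarrow> ('u, 'f, 'r) lstruct \<Rightarrow> 'u list \<Rightarrow> 'u set \<Rightarrow> 'u set \<Rightarrow> bool" where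
  "lascar_splits \<tau> \<delta> N a B A \<longleftrightarrow>
     (\<exists>b\<in>lists B. \<exists>c\<in>lists B. same_Lt \<tau> \<delta> N A b c \<and> \<not> same_tp \<tau> N A (a @ b) (a @ c))"

text \<open>\<open>a \<down>\<^sub>B C\<close> computed in \<open>N\<close>.  "Boundedly many classes" means fewer than \<open>\<delta>\<close> classes, and \<open>\<kappa>\<close>
  is the cardinal for which \<open>N\<close> is model homogeneous and universal; it bounds the size of the
  sets \<open>D\<close>.  For \<open>N = \<bbbM>\<close> it is \<open>\<delta>\<close>; for \<open>N = \<bbbM>'\<close> it is \<open>|\<bbbM>'|\<close>, since there \<open>\<bbbM> \<subseteq> D\<close> occurs.\<close>

definition indep ::
  "('f, 'r) vocab \<Rightarrow> 'c rel \<Rightarrow> 'd rel \<Rightarrow> ('u, 'f, 'r) lstruct \<Rightarrow> 'u list \<Rightarrow> 'u set \<Rightarrow> 'u set \<Rightarrow> bool"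
where
  "indep \<tau> \<delta> \<kappa> N a B C \<longleftrightarrow>
     (\<exists>A\<subseteq>B. finite A \<and>
        (\<forall>D. B \<union> C \<subseteq> D \<and> D \<subseteq> univ N \<and> |D| <o \<kappa> \<longrightarrow>
           (\<exists>b\<in>lists (univ N). same_tp \<tau> N (B \<union> C) b a \<and> \<not> lascar_splits \<tau> \<delta> N b D A)))"


section \<open>Imaginaries\<close>

text \<open>An imaginary \<open>a/E\<close> is the pair of \<open>E\<close> and the \<open>E\<close>-class of \<open>a\<close>, so that the predicates \<open>P\<^sub>E\<close>
  are disjoint; \<open>a \<in> \<bbbM>\<close> is identified with \<open>a/=\<close> through \<open>real_elem M\<close>.\<close>

type_synonym 'u imag = "('u list \<times> 'u list) set \<times> 'u list set"

definition cls :: "('u list \<times> 'u list) set \<Rightarrow> 'u list \<Rightarrow> 'u imag" where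
  "cls E a = (E, E `` {a})"

definition equality_rel :: "('u, 'f, 'r) lstruct \<Rightarrow> ('u list \<times> 'u list) set" where
  "equality_rel M = Id_on (tuples (univ M) 1)"

definition real_elem :: "('u, 'f, 'r) lstruct \<Rightarrow> 'u \<Rightarrow> 'u imag" where
  "real_elem M x = cls (equality_rel M) [x]"

text \<open>Vocabulary and structure of \<open>\<bbbM>\<^sup>e\<^sup>q\<close>.  The functions of \<open>\<bbbM>\<close> and the functions \<open>F\<^sub>E\<close> are defined
  only on the sort \<open>P\<^sub>=\<close> and are therefore given by their graphs.\<close>

datatype ('f, 'r, 'u) eq_sym =
    Graph 'f
  | Rel 'r
  | Sort "('u list \<times> 'u list) set"
  | Proj "('u list \<times> 'u list) set"

definition eq_vocab ::
  "('f, 'r) vocab \<Rightarrow> ('u list \<times> 'u list) set set \<Rightarrow> ('f, ('f, 'r, 'u) eq_sym) vocab" where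
  "eq_vocab \<tau> \<E> =
     \<lparr>fsyms = {},
      rsyms = Graph ` fsyms \<tau> \<union> Rel ` rsyms \<tau> \<union> Sort ` \<E> \<union> Proj ` \<E>,
      farity = (\<lambda>_. 0),
      rarity = (\<lambda>s. case s of Graph f \<Rightarrow> Suc (farity \<tau> f) | Rel r \<Rightarrow> rarity \<tau> r | Sort E \<Rightarrow> 1
                    | Proj E \<Rightarrow> Suc (length (SOME a. a \<in> Domain E)))\<rparr>"

definition eq_struct ::
  "('f, 'r) vocab \<Rightarrow> ('u, 'f, 'r) lstruct \<Rightarrow> ('u list \<times> 'u list) set set \<Rightarrow>
   ('u imag, 'f, ('f, 'r, 'u) eq_sym) lstruct" where
  "eq_struct \<tau> M \<E> =
     \<lparr>univ = {cls E a |E a. E \<in> \<E> \<and> a \<in> Domain E},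
      fun_of = (\<lambda>_ _. undefined),
      rel_of = (\<lambda>s. case s of
          Graph f \<Rightarrow> if f \<in> fsyms \<tau>
                    then {map (real_elem M) (xs @ [fun_of M f xs]) |xs. xs \<in> tuples (univ M) (farity \<tau> f)}
                    else {}
        | Rel r \<Rightarrow> if r \<in> rsyms \<tau> then map (real_elem M) ` rel_of M r else {}
        | Sort E \<Rightarrow> if E \<in> \<E> then {[cls E a] |a. a \<in> Domain E} else {}
        | Proj E \<Rightarrow> if E \<in> \<E> then {map (real_elem M) a @ [cls E a] |a. a \<in> Domain E} else {})\<rparr>"


section \<open>Global types and canonical bases\<close>

definition supermonster ::
  "('f, 'r) vocab \<Rightarrow> (('u, 'f, 'r) lstruct \<Rightarrow> ('u, 'f, 'r) lstruct \<Rightarrow> bool) \<Rightarrow>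
   ('u, 'f, 'r) lstruct set \<Rightarrow> ('u, 'f, 'r) lstruct \<Rightarrow> ('u, 'f, 'r) lstruct \<Rightarrow> bool" where
  "supermonster \<tau> le K M M' \<longleftrightarrow>
     monster \<tau> le K |univ M'| M' \<and> le M M' \<and> |univ M| <o |univ M'|"

text \<open>\<open>p A\<close> is a Galois type over \<open>A\<close>, represented by its set of realizations in \<open>\<bbbM>'\<close>.  Maximality
  of the collection means that there is a \<open>p A\<close> for every finite \<open>A \<subseteq> \<bbbM>\<close>; the value of \<open>p\<close> on
  other sets is irrelevant.\<close>

definition global_type ::
  "('f, 'r) vocab \<Rightarrow> ('u, 'f, 'r) lstruct \<Rightarrow> ('u, 'f, 'r) lstruct \<Rightarrow> ('u set \<Rightarrow> 'u list set) \<Rightarrow> bool"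
where
  "global_type \<tau> M M' p \<longleftrightarrow>
     (\<forall>A\<subseteq>univ M. finite A \<longrightarrow> (\<exists>x\<in>lists (univ M'). p A = gtp \<tau> M' A x)) \<and>
     (\<forall>A B. A \<subseteq> B \<and> B \<subseteq> univ M \<and> finite B \<longrightarrow> (\<forall>b\<in>lists (univ M). b \<in> p B \<longrightarrow> b \<in> p A)) \<and>
     (\<exists>b\<in>lists (univ M'). \<forall>A\<subseteq>univ M. finite A \<longrightarrow> b \<in> p A)"

text \<open>\<open>t(b/\<bbbM>)\<close> as a global type.\<close>

definition tp_over_monster ::
  "('f, 'r) vocab \<Rightarrow> ('u, 'f, 'r) lstruct \<Rightarrow> 'u list \<Rightarrow> 'u set \<Rightarrow> 'u list set" where
  "tp_over_monster \<tau> M' b = (\<lambda>A. gtp \<tau> M' A b)"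

text \<open>\<open>f(p) = p\<close> for \<open>f \<in> Aut(\<bbbM>\<^sup>e\<^sup>q)\<close>; the tuple \<open>b'\<close> below is \<open>f(b)\<close>, read in \<open>\<bbbM>\<close>.\<close>

definition fixes_type ::
  "('u, 'f, 'r) lstruct \<Rightarrow> ('u imag \<Rightarrow> 'u imag) \<Rightarrow> ('u set \<Rightarrow> 'u list set) \<Rightarrow> bool" where
  "fixes_type M f p \<longleftrightarrow>
     (\<forall>A B. A \<subseteq> univ M \<and> B \<subseteq> univ M \<and> finite A \<and> finite B \<and>
            f ` real_elem M ` B = real_elem M ` A \<longrightarrow>
        (\<forall>b\<in>lists (univ M). \<forall>b'\<in>lists (univ M).
           b \<in> p B \<and> map f (map (real_elem M) b) = map (real_elem M) b' \<longrightarrow> b' \<in> p A))"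

text \<open>As everywhere, the canonical base may be a finite tuple.\<close>

definition canonical_base ::
  "('f, 'r) vocab \<Rightarrow> ('u, 'f, 'r) lstruct \<Rightarrow> ('u, 'f, 'r) lstruct \<Rightarrow> ('u list \<times> 'u list) set set \<Rightarrow>
   ('u set \<Rightarrow> 'u list set) \<Rightarrow> 'u imag list \<Rightarrow> bool" where
  "canonical_base \<tau> M M' \<E> p \<alpha> \<longleftrightarrow>
     global_type \<tau> M M' p \<and> \<alpha> \<in> lists (univ (eq_struct \<tau> M \<E>)) \<and>
     (\<forall>f\<in>Aut (eq_vocab \<tau> \<E>) (eq_struct \<tau> M \<E>). fixes_type M f p \<longleftrightarrow> map f \<alpha> = \<alpha>)"

text \<open>\<open>\<alpha> = Cb(a/A)\<close>.\<close>

definition is_Cb ::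
  "('f, 'r) vocab \<Rightarrow> 'c rel \<Rightarrow> ('u, 'f, 'r) lstruct \<Rightarrow> ('u, 'f, 'r) lstruct \<Rightarrow>
   ('u list \<times> 'u list) set set \<Rightarrow> 'u list \<Rightarrow> 'u set \<Rightarrow> 'u imag list \<Rightarrow> bool" where
  "is_Cb \<tau> \<delta> M M' \<E> a A \<alpha> \<longleftrightarrow>
     (\<exists>b\<in>lists (univ M'). same_Lt \<tau> \<delta> M' A b a \<and> indep \<tau> \<delta> |univ M'| M' b A (univ M) \<and>
        canonical_base \<tau> M M' \<E> (tp_over_monster \<tau> M' b) \<alpha>)"

text \<open>The relation \<open>E\<close> obtained from \<open>n\<close>-tuples and the types \<open>q\<^sub>i\<^sup>c\<close>, where \<open>Q c = {q\<^sub>i\<^sup>c. i < \<omega>}\<close>.\<close>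

definition cb_rel ::
  "('u, 'f, 'r) lstruct \<Rightarrow> nat \<Rightarrow> ('u list \<Rightarrow> 'u list set set) \<Rightarrow> ('u list \<times> 'u list) set" where
  "cb_rel M n Q = {(a0, a1). a0 \<in> tuples (univ M) n \<and> a1 \<in> tuples (univ M) n \<and>
     (\<forall>c\<in>lists (univ M). \<forall>d\<in>lists (univ M). a0 @ d \<in> \<Union>(Q c) \<longleftrightarrow> a1 @ d \<in> \<Union>(Q c))}"

text \<open>Admissible collections \<open>\<E>\<close>.  In \<open>cb_rels\<close> the sets \<open>Q c\<close> are not determined by their defining
  property; for every \<open>(b, a)\<close> the collection \<open>\<E>\<close> contains the relation obtained from some choice of them
  (requiring it for all choices could conflict with countability).\<close>

locale imaginaries =
  fixes \<tau> :: "('f, 'r) vocab"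
    and M M' :: "('u, 'f, 'r) lstruct"
    and \<E> :: "('u list \<times> 'u list) set set"
  assumes countable: "countable \<E>"
    and equality: "equality_rel M \<in> \<E>"
    and invariant: "\<forall>E\<in>\<E>. \<exists>n. equiv (tuples (univ M) n) E \<and>
          (\<forall>f\<in>Aut \<tau> M. \<forall>(a, b)\<in>E. (map f a, map f b) \<in> E) \<and>
          (\<exists>G \<subseteq> gtp \<tau> M {} ` lists (univ M). countable G \<and>
             (\<forall>a\<in>tuples (univ M) n. \<forall>b\<in>tuples (univ M) n.
                (a, b) \<in> E \<longleftrightarrow> gtp \<tau> M {} (a @ b) \<in> G))"
    and cb_rels: "\<forall>b\<in>lists (univ M'). \<forall>a\<in>lists (univ M). \<not> splits \<tau> M' b (univ M) (set a) \<longrightarrow>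
          (\<exists>Q. (\<forall>c\<in>lists (univ M).
                  countable (Q c) \<and> Q c \<subseteq> gtp \<tau> M {} ` lists (univ M) \<and>
                  (\<forall>d\<in>lists (univ M). same_tp \<tau> M' {} (b @ d) (b @ c) \<longleftrightarrow> a @ d \<in> \<Union>(Q c))) \<and>
               cb_rel M (length a) Q \<in> \<E>)"

end

theory Submission
  imports Defs "HOL-Library.Countable_Set_Type"
begin

text \<open>
  Let \<open>p\<close> be the global type of which \<open>\<alpha>\<close> is a canonical base.  It does not Lascar split over \<open>A\<close>, so it
  is fixed by every automorphism of \<open>\<bbbM>\<close> over \<open>A\<close> that fixes all classes of all bounded
  \<open>A\<close>-invariant equivalence relations.  By (AI) every orbit of \<open>Aut(\<bbbM>/A)\<close> on tuples meets a given
  countable model containing \<open>A\<close>; hence there are at most \<open>2\<^sup>\<omega>\<close> such relations, and since \<open>\<delta>\<close> is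
  inaccessible only boundedly many ways to permute their classes.  Two automorphisms that permute
  the classes in the same way move \<open>\<alpha>\<close> to the same tuple.
\<close>

section \<open>Automorphisms and Galois types\<close>

lemma AutD:
  assumes "f \<in> Aut \<tau> N"
  shows "inj_on f (univ N)" "f ` univ N = univ N"
  using assms by (auto simp: Aut_def iso_def bij_betw_def)

lemma Aut_in_univ: "f \<in> Aut \<tau> N \<Longrightarrow> x \<in> univ N \<Longrightarrow> f x \<in> univ N"
  using AutD(2) by blast

lemma Aut_tuples:
  assumes "f \<in> Aut \<tau> N" "xs \<in> tuples (univ N) n"
  shows "map f xs \<in> tuples (univ N) n"
  using assms(2) Aut_in_univ[OF assms(1)] by (auto simp: tuples_def)

lemma Aut_lists:
  assumes "f \<in> Aut \<tau> N" "xs \<in> lists (univ N)"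
  shows "map f xs \<in> lists (univ N)"
  using assms(2) Aut_in_univ[OF assms(1)] by auto

lemma Aut_comp:
  assumes f: "f \<in> Aut \<tau> N" and g: "g \<in> Aut \<tau> N"
  shows "g \<circ> f \<in> Aut \<tau> N"
proof -
  have "bij_betw (g \<circ> f) (univ N) (univ N)"
    using f g by (auto simp: Aut_def iso_def intro: bij_betw_trans)
  moreover have "(g \<circ> f) (fun_of N s xs) = fun_of N s (map (g \<circ> f) xs)"
    if "s \<in> fsyms \<tau>" "xs \<in> tuples (univ N) (farity \<tau> s)" for s xs
    using that f g Aut_tuples[OF f that(2)] by (auto simp: Aut_def iso_def)
  moreover have "xs \<in> rel_of N s \<longleftrightarrow> map (g \<circ> f) xs \<in> rel_of N s"
    if "s \<in> rsyms \<tau>" "xs \<in> tuples (univ N) (rarity \<tau> s)" for s xs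
  proof -
    have "xs \<in> rel_of N s \<longleftrightarrow> map f xs \<in> rel_of N s"
      using that f by (auto simp: Aut_def iso_def)
    also have "\<dots> \<longleftrightarrow> map g (map f xs) \<in> rel_of N s"
      using that g Aut_tuples[OF f that(2)] by (auto simp: Aut_def iso_def)
    finally show ?thesis by simp
  qed
  ultimately show ?thesis by (auto simp: Aut_def iso_def)
qed

text \<open>\<open>inv_into\<close> inverts \<open>f\<close> only on the universe, which is all that
  \<open>Aut\<close> constrains. Closure under the functions is assumed instead of
  \<open>is_struct\<close>, so that the structure of imaginaries is covered too: its vocabulary is
  relational and closure is vacuous there.\<close>

lemma Aut_inverse:
  assumes f: "f \<in> Aut \<tau> N"
    and closed: "\<And>s xs. s \<in> fsyms \<tau> \<Longrightarrow> xs \<in> tuples (univ N) (farity \<tau> s) \<Longrightarrow> fun_of N s xs \<in> univ N"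
  obtains g where "g \<in> Aut \<tau> N" "\<And>x. x \<in> univ N \<Longrightarrow> g (f x) = x" "\<And>x. x \<in> univ N \<Longrightarrow> f (g x) = x"
proof -
  define g where "g = inv_into (univ N) f"
  have gf: "g (f x) = x" if "x \<in> univ N" for x
    unfolding g_def using AutD(1)[OF f] that by (rule inv_into_f_f)
  have fg: "f (g x) = x" if "x \<in> univ N" for x
    unfolding g_def using AutD(2)[OF f] that by (simp add: f_inv_into_f)
  have g_bij: "bij_betw g (univ N) (univ N)"
    unfolding g_def using f by (auto simp: Aut_def iso_def intro: bij_betw_inv_into)
  have pre: "\<exists>ys\<in>tuples (univ N) n. xs = map f ys \<and> map g xs = ys" if "xs \<in> tuples (univ N) n" for xs n
  proof (intro bexI conjI)
    show "map g xs \<in> tuples (univ N) n"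
      using that bij_betwE[OF g_bij] by (auto simp: tuples_def)
    show "xs = map f (map g xs)"
      using that fg by (auto simp: tuples_def intro!: map_idI[symmetric])
  qed simp
  have "g (fun_of N s xs) = fun_of N s (map g xs)"
    if s: "s \<in> fsyms \<tau>" and xs: "xs \<in> tuples (univ N) (farity \<tau> s)" for s xs
  proof -
    obtain ys where ys: "ys \<in> tuples (univ N) (farity \<tau> s)" "xs = map f ys" "map g xs = ys"
      using pre[OF xs] by blast
    have "f (fun_of N s ys) = fun_of N s xs"
      using f s ys by (auto simp: Aut_def iso_def)
    then show ?thesis using gf[OF closed[OF s ys(1)]] ys(3) by simp
  qed
  moreover have "xs \<in> rel_of N s \<longleftrightarrow> map g xs \<in> rel_of N s"
    if s: "s \<in> rsyms \<tau>" and xs: "xs \<in> tuples (univ N) (rarity \<tau> s)" for s xs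
  proof -
    obtain ys where ys: "ys \<in> tuples (univ N) (rarity \<tau> s)" "xs = map f ys" "map g xs = ys"
      using pre[OF xs] by blast
    show ?thesis unfolding ys(3) unfolding ys(2) using f s ys(1) by (auto simp: Aut_def iso_def)
  qed
  ultimately have "g \<in> Aut \<tau> N" using g_bij by (auto simp: Aut_def iso_def)
  then show ?thesis using that gf fg by blast
qed

lemma is_struct_closed:
  "is_struct \<tau> N \<Longrightarrow> s \<in> fsyms \<tau> \<Longrightarrow> xs \<in> tuples (univ N) (farity \<tau> s) \<Longrightarrow> fun_of N s xs \<in> univ N"
  unfolding is_struct_def by metis

lemma AutOver_mono: "A \<subseteq> B \<Longrightarrow> AutOver \<tau> N B \<subseteq> AutOver \<tau> N A"
  by (auto simp: AutOver_def)

lemma AutOver_empty [simp]: "AutOver \<tau> N {} = Aut \<tau> N"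
  by (simp add: AutOver_def)

lemma same_gtp_sym:
  assumes "is_struct \<tau> N" "A \<subseteq> univ N" "a \<in> lists (univ N)" "same_gtp \<tau> N A a b"
  shows "same_gtp \<tau> N A b a"
proof -
  obtain f where f: "f \<in> Aut \<tau> N" "\<forall>x\<in>A. f x = x" "map f a = b"
    using assms(4) by (auto simp: same_gtp_def AutOver_def)
  obtain g where g: "g \<in> Aut \<tau> N" "\<And>x. x \<in> univ N \<Longrightarrow> g (f x) = x"
    using Aut_inverse[OF f(1)] is_struct_closed[OF assms(1)] by metis
  have "map g b = a" using assms(3) g(2) f(3) by (auto intro!: map_idI)
  moreover have "\<forall>x\<in>A. g x = x" using f(2) g(2) assms(2) by (metis subsetD)
  ultimately show ?thesis using g(1) by (auto simp: same_gtp_def AutOver_def)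
qed

lemma same_gtp_trans:
  assumes "same_gtp \<tau> N A a b" "same_gtp \<tau> N A b c"
  shows "same_gtp \<tau> N A a c"
proof -
  obtain f g where "f \<in> Aut \<tau> N" "\<forall>x\<in>A. f x = x" "map f a = b"
    "g \<in> Aut \<tau> N" "\<forall>x\<in>A. g x = x" "map g b = c"
    using assms by (auto simp: same_gtp_def AutOver_def)
  then show ?thesis
    using Aut_comp[of f \<tau> N g]
    by (auto simp: same_gtp_def AutOver_def intro!: bexI[of _ "g \<circ> f"])
qed

lemma same_gtp_append_fixed:
  assumes "f \<in> AutOver \<tau> N (A \<union> set c)" "map f a = b"
  shows "same_gtp \<tau> N A (a @ c) (b @ c)"
  using assms by (auto simp: same_gtp_def AutOver_def intro!: bexI[of _ f] map_idI)

text \<open>Parameters move from the tuple into the base: equal lengths force the witnessing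
  automorphism to map \<open>c\<close> to itself entry by entry.\<close>

lemma same_gtp_over_set:
  assumes "same_gtp \<tau> N {} (a @ c) (b @ c)" "length a = length b"
  shows "same_gtp \<tau> N (set c) a b"
proof -
  obtain f where f: "f \<in> Aut \<tau> N" "map f a = b" "map f c = c"
    using assms by (auto simp: same_gtp_def)
  have "\<forall>x\<in>set c. f x = x"
    using f(3) map_eq_conv[of f c id] by simp
  then show ?thesis using f by (auto simp: same_gtp_def AutOver_def)
qed

lemma same_tp_finite:
  assumes "finite A"
  shows "same_tp \<tau> N A a b \<longleftrightarrow> same_gtp \<tau> N A a b"
  using assms AutOver_mono[of _ A \<tau> N] unfolding same_tp_def same_gtp_def by blast

section \<open>Bounded invariant equivalence relations\<close>

lemma lascar_relsD:
  assumes "E \<in> lascar_rels \<tau> \<delta> N A n"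
  shows "equiv (tuples (univ N) n) E" "|tuples (univ N) n // E| <o \<delta>"
    "f \<in> AutOver \<tau> N A \<Longrightarrow> (a, b) \<in> E \<Longrightarrow> (map f a, map f b) \<in> E"
  using assms unfolding lascar_rels_def by blast+

lemma lascar_relsI:
  assumes "equiv (tuples (univ N) n) E" "|tuples (univ N) n // E| <o \<delta>"
    "\<And>f a b. f \<in> AutOver \<tau> N A \<Longrightarrow> (a, b) \<in> E \<Longrightarrow> (map f a, map f b) \<in> E"
  shows "E \<in> lascar_rels \<tau> \<delta> N A n"
  using assms unfolding lascar_rels_def by blast

lemma lascar_rels_mono: "A \<subseteq> B \<Longrightarrow> lascar_rels \<tau> \<delta> N A n \<subseteq> lascar_rels \<tau> \<delta> N B n"
  using AutOver_mono[of A B \<tau> N] by (auto intro!: lascar_relsI dest: lascar_relsD)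

text \<open>Lascar types of elements of \<open>M'\<close> refer to relations on \<open>M'\<close>,
  while the counting takes place in \<open>M\<close>. Traces stay invariant because automorphisms of
  \<open>M\<close> extend to \<open>M'\<close>, and they stay bounded because each class of the
  trace is cut out by a class of \<open>E\<close>.\<close>

lemma lascar_rels_restrict:
  assumes E: "E \<in> lascar_rels \<tau> \<delta> M' A n" and sub: "univ M \<subseteq> univ M'" and A: "A \<subseteq> univ M"
    and ext: "\<And>f. f \<in> Aut \<tau> M \<Longrightarrow> \<exists>g\<in>Aut \<tau> M'. \<forall>x\<in>univ M. g x = f x"
  shows "E \<inter> tuples (univ M) n \<times> tuples (univ M) n \<in> lascar_rels \<tau> \<delta> M A n"
    (is "?E \<in> _")
proof -
  have tup: "tuples (univ M) n \<subseteq> tuples (univ M') n"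
    using sub by (auto simp: tuples_def)
  note eq = lascar_relsD(1)[OF E] and bd = lascar_relsD(2)[OF E] and inv = lascar_relsD(3)[OF E]
  have "equiv (tuples (univ M) n) ?E"
    using eq tup unfolding equiv_def refl_on_def sym_def trans_def by blast
  moreover have "(map f a, map f b) \<in> ?E" if f: "f \<in> AutOver \<tau> M A" and ab: "(a, b) \<in> ?E" for f a b
  proof -
    obtain g where g: "g \<in> Aut \<tau> M'" "\<forall>x\<in>univ M. g x = f x"
      using ext[of f] f by (auto simp: AutOver_def)
    have "g \<in> AutOver \<tau> M' A" using g f A by (auto simp: AutOver_def)
    then have "(map g a, map g b) \<in> E" using inv ab by blast
    moreover have "map g a = map f a" "map g b = map f b"
      using ab g(2) by (auto simp: tuples_def)
    ultimately show ?thesis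
      using ab Aut_tuples[of f \<tau> M] f by (auto simp: AutOver_def)
  qed
  moreover have "|tuples (univ M) n // ?E| <o \<delta>"
  proof -
    have "tuples (univ M) n // ?E \<subseteq> (\<lambda>C. C \<inter> tuples (univ M) n) ` (tuples (univ M') n // E)"
    proof
      fix C assume "C \<in> tuples (univ M) n // ?E"
      then obtain c where c: "c \<in> tuples (univ M) n" "C = ?E `` {c}" by (auto elim: quotientE)
      then have "C = E `` {c} \<inter> tuples (univ M) n" by auto
      then show "C \<in> (\<lambda>C. C \<inter> tuples (univ M) n) ` (tuples (univ M') n // E)"
        using c(1) tup by (auto intro: quotientI)
    qed
    then have "|tuples (univ M) n // ?E| \<le>o |tuples (univ M') n // E|"
      by (meson card_of_image card_of_mono1 ordLeq_transitive)
    then show ?thesis using bd by (rule ordLeq_ordLess_trans)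
  qed
  ultimately show ?thesis by (intro lascar_relsI)
qed

section \<open>Counting relations and their classes below an inaccessible cardinal\<close>

lemma inaccessible_Pow:
  assumes "inaccessible (\<delta> :: 'c rel)" "|X :: 'a set| <o \<delta>"
  shows "|Pow X| <o \<delta>"
proof -
  have co: "Card_order \<delta>" using assms by (simp add: inaccessible_def)
  \<comment> \<open>The strong limit clause of \<open>inaccessible\<close> speaks only of subsets of
    \<open>Field \<delta>\<close>, so \<open>X\<close> is first copied into that field.\<close>
  have "|X| \<le>o |Field \<delta>|"
    using assms(2) co card_of_Field_ordIso ordIso_symmetric ordLess_imp_ordLeq ordLeq_ordIso_trans by blast
  then obtain f where f: "inj_on f X" "f ` X \<subseteq> Field \<delta>"
    using card_of_ordLeq[of X "Field \<delta>"] by blast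
  have "|f ` X| <o \<delta>"
    using card_of_image assms(2) by (rule ordLeq_ordLess_trans)
  then have "|Pow (f ` X)| <o \<delta>"
    using assms(1) f(2) unfolding inaccessible_def by blast
  moreover have "|Pow X| \<le>o |Pow (f ` X)|"
    using inj_on_image_Pow[OF f(1)] by (rule card_of_ordLeqI) auto
  ultimately show ?thesis by (rule ordLeq_ordLess_trans[rotated])
qed

text \<open>An \<open>A\<close>-invariant relation is determined by its trace on \<open>X\<close>,
  since by s-saturation every pair of tuples is the image of a pair from \<open>X\<close> under an
  automorphism over \<open>A\<close>. Thus there are at most as many relations as subsets of a
  countable set.\<close>

lemma countable_lascar_bound:
  assumes inacc: "inaccessible (\<delta> :: 'c rel)" and M: "is_struct \<tau> M" and X: "countable X" "X \<subseteq> univ M"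
    and sat: "s_saturated \<tau> M X" and A: "A \<subseteq> X" "finite A"
  shows "|\<Union>n. lascar_rels \<tau> \<delta> M A n| <o \<delta>"
proof -
  let ?L = "\<Union>n. lascar_rels \<tau> \<delta> M A n" and ?S = "lists X \<times> lists X"
  have sub: "E \<subseteq> E'" if EL: "E \<in> ?L" and EL': "E' \<in> ?L" and eq: "E \<inter> ?S = E' \<inter> ?S" for E E'
  proof
    fix p assume p: "p \<in> E"
    obtain a b where ab: "p = (a, b)" by (cases p)
    obtain n m where E: "E \<in> lascar_rels \<tau> \<delta> M A n" and E': "E' \<in> lascar_rels \<tau> \<delta> M A m"
      using EL EL' by blast
    have "E \<subseteq> tuples (univ M) n \<times> tuples (univ M) n"
      using equiv_type[OF lascar_relsD(1)[OF E]] .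
    \<comment> \<open>Saturation is applied to the concatenation, so that a single automorphism
      serves both components; the realization \<open>s\<close> found in \<open>X\<close> is then cut
      at \<open>length a\<close>.\<close>
    then have abM: "a @ b \<in> lists (univ M)" using p ab by (auto simp: tuples_def)
    obtain s where s: "s \<in> lists X" "same_tp \<tau> M A s (a @ b)"
      using sat abM A unfolding s_saturated_def by blast
    obtain f where f: "f \<in> AutOver \<tau> M A" "map f s = a @ b"
      using s(2) by (auto simp: same_tp_finite[OF A(2)] same_gtp_def)
    define s1 s2 where "s1 = take (length a) s" and "s2 = drop (length a) s"
    have s12: "map f s1 = a" "map f s2 = b" "s1 \<in> lists X" "s2 \<in> lists X"
      using f(2) s(1) unfolding s1_def s2_def
      by (auto simp flip: take_map drop_map dest: in_set_takeD in_set_dropD)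
    have fA: "f \<in> Aut \<tau> M" "\<forall>x\<in>A. f x = x" using f by (auto simp: AutOver_def)
    \<comment> \<open>The pair is pulled back into \<open>X\<close> inside \<open>E\<close> by the
      inverse \<open>g\<close>, passes to \<open>E'\<close> because the traces agree, and returns
      inside \<open>E'\<close> by \<open>f\<close>.\<close>
    obtain g where g: "g \<in> Aut \<tau> M" "\<And>x. x \<in> univ M \<Longrightarrow> g (f x) = x"
      using Aut_inverse[OF fA(1)] is_struct_closed[OF M] by metis
    have "\<forall>x\<in>A. g x = x" using g(2) fA(2) A(1) X(2) by (metis subset_iff)
    then have "g \<in> AutOver \<tau> M A" using g(1) by (simp add: AutOver_def)
    then have "(map g a, map g b) \<in> E"
      using lascar_relsD(3)[OF E] p ab by blast
    moreover have "map g a = s1" "map g b = s2"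
      using s12 g(2) X(2) by (auto intro!: map_idI simp: subset_iff)
    ultimately have "(s1, s2) \<in> E'" using eq s12(3,4) by blast
    then have "(map f s1, map f s2) \<in> E'" using lascar_relsD(3)[OF E'] f(1) by blast
    then show "p \<in> E'" using s12 ab by simp
  qed
  then have "inj_on (\<lambda>E. E \<inter> ?S) ?L" by (intro inj_onI subset_antisym) auto
  then have "|?L| \<le>o |Pow ?S|" by (rule card_of_ordLeqI) auto
  moreover have "countable ?S" using X(1) by auto
  then have "|?S| \<le>o natLeq" by (simp add: countable_card_le_natLeq)
  then have "|?S| <o \<delta>" using inacc by (auto simp: inaccessible_def intro: ordLeq_ordLess_trans)
  ultimately show ?thesis using inaccessible_Pow[OF inacc] ordLeq_ordLess_trans by blast
qed

text \<open>This is regularity of \<open>\<delta>\<close>, used in the form of stability, which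
  requires that \<open>\<delta>\<close> be infinite.\<close>

lemma inaccessible_Sigma:
  assumes "inaccessible \<delta>" "|I| <o \<delta>" "\<And>i. i \<in> I \<Longrightarrow> |F i| <o \<delta>"
  shows "|Sigma I F| <o \<delta>"
proof -
  have \<delta>: "Card_order \<delta>" "natLeq <o \<delta>" "regularCard \<delta>"
    using assms(1) by (simp_all add: inaccessible_def)
  have "natLeq \<le>o |Field \<delta>|"
    using ordLess_imp_ordLeq[OF \<delta>(2)] ordIso_symmetric[OF card_of_Field_ordIso[OF \<delta>(1)]]
    by (rule ordLeq_ordIso_trans)
  then have "\<not> finite (Field \<delta>)" using infinite_iff_natLeq_ordLeq[of "Field \<delta>"] by simp
  with \<delta> have "stable \<delta>" by (intro regularCard_stable)
  then show ?thesis using assms(2,3) by (rule stable_elim)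
qed

text \<open>Embeds the ways in which automorphisms permute the classes of bounded relations into a power
  set of size below \<open>\<delta>\<close>.\<close>

lemma inj_action_bound:
  assumes inacc: "inaccessible (\<delta> :: 'c rel)" and L: "|\<Union>n. lascar_rels \<tau> \<delta> M A n| <o \<delta>"
    and F: "\<And>\<beta>. \<beta> \<in> B \<Longrightarrow> F \<beta> \<in> AutOver \<tau> M A"
    and inj: "\<And>\<beta> \<gamma>. \<beta> \<in> B \<Longrightarrow> \<gamma> \<in> B \<Longrightarrow>
      (\<And>n E c. E \<in> lascar_rels \<tau> \<delta> M A n \<Longrightarrow> c \<in> tuples (univ M) n \<Longrightarrow> (map (F \<beta>) c, map (F \<gamma>) c) \<in> E)
      \<Longrightarrow> \<beta> = \<gamma>"
  shows "|B| <o \<delta>"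
proof -
  let ?L = "\<Union>n. lascar_rels \<tau> \<delta> M A n"
  \<comment> \<open>\<open>T\<close> collects all classes of all the bounded relations, each tagged
    with its relation, and \<open>\<Phi> \<beta>\<close> is the graph of the map that
    \<open>F \<beta>\<close> induces on \<open>T\<close>. Writing \<open>Domain E\<close> avoids
    having to carry the arity of \<open>E\<close> along.\<close>
  define T where "T = Sigma ?L (\<lambda>E. Domain E // E)"
  define \<Phi> where "\<Phi> \<beta> = {((E, E `` {c}), (E, E `` {map (F \<beta>) c}))|E c. E \<in> ?L \<and> c \<in> Domain E}" for \<beta>
  have dom: "Domain E = tuples (univ M) n" if "E \<in> lascar_rels \<tau> \<delta> M A n" for E n
    using equiv_type[OF lascar_relsD(1)[OF that]] equiv_class_self[OF lascar_relsD(1)[OF that]]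
    by blast
  have "|Domain E // E| <o \<delta>" if E: "E \<in> ?L" for E
  proof -
    obtain n where n: "E \<in> lascar_rels \<tau> \<delta> M A n" using E by blast
    show ?thesis unfolding dom[OF n] by (rule lascar_relsD(2)[OF n])
  qed
  then have T: "|T| <o \<delta>" unfolding T_def by (rule inaccessible_Sigma[OF inacc L])
  then have Pow: "|Pow (T \<times> T)| <o \<delta>"
    by (intro inaccessible_Pow[OF inacc] inaccessible_Sigma[OF inacc])
  have mem: "map (F \<beta>) c \<in> tuples (univ M) n" if "\<beta> \<in> B" "c \<in> tuples (univ M) n" for \<beta> c n
  proof -
    have "F \<beta> \<in> Aut \<tau> M" using F[OF that(1)] by (simp add: AutOver_def)
    then show ?thesis using that(2) by (rule Aut_tuples)
  qed
  have "inj_on \<Phi> B"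
  proof (rule inj_onI, rule inj)
    fix \<beta> \<gamma> n E c
    assume B: "\<beta> \<in> B" "\<gamma> \<in> B" and eq: "\<Phi> \<beta> = \<Phi> \<gamma>"
      and E: "E \<in> lascar_rels \<tau> \<delta> M A n" and c: "c \<in> tuples (univ M) n"
    note equiv = lascar_relsD(1)[OF E]
    have "((E, E `` {c}), (E, E `` {map (F \<beta>) c})) \<in> \<Phi> \<gamma>"
      using E c dom[OF E] unfolding eq[symmetric] unfolding \<Phi>_def mem_Collect_eq
      by (intro exI[of _ E] exI[of _ c] conjI refl) auto
    \<comment> \<open>Membership in \<open>\<Phi> \<gamma>\<close> may be witnessed by another
      representative \<open>d\<close> of the class of \<open>c\<close>; invariance of
      \<open>E\<close> under \<open>F \<gamma>\<close> leads back to \<open>c\<close>.\<close>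
    then obtain d where d: "d \<in> Domain E" "E `` {c} = E `` {d}"
      "E `` {map (F \<beta>) c} = E `` {map (F \<gamma>) d}"
      unfolding \<Phi>_def mem_Collect_eq prod.inject by blast
    have "(c, d) \<in> E" using eq_equiv_class[OF d(2) equiv] d(1) dom[OF E] by simp
    then have "(map (F \<gamma>) c, map (F \<gamma>) d) \<in> E" by (rule lascar_relsD(3)[OF E F[OF B(2)]])
    then have "E `` {map (F \<gamma>) c} = E `` {map (F \<gamma>) d}" by (rule equiv_class_eq[OF equiv])
    with d(3) have "E `` {map (F \<beta>) c} = E `` {map (F \<gamma>) c}" by (rule trans[OF _ sym])
    then show "(map (F \<beta>) c, map (F \<gamma>) c) \<in> E" using equiv mem[OF B(2) c] by (rule eq_equiv_class)
  qed auto
  moreover have "\<Phi> \<beta> \<in> Pow (T \<times> T)" if "\<beta> \<in> B" for \<beta>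
  proof -
    have "(E, E `` {c}) \<in> T \<and> (E, E `` {map (F \<beta>) c}) \<in> T"
      if E: "E \<in> ?L" and c: "c \<in> Domain E" for E c
    proof -
      obtain n where n: "E \<in> lascar_rels \<tau> \<delta> M A n" using E by blast
      then have "map (F \<beta>) c \<in> Domain E" using mem[OF \<open>\<beta> \<in> B\<close>] c dom[OF n] by simp
      then show ?thesis using E c unfolding T_def by (intro conjI SigmaI quotientI)
    qed
    then show ?thesis unfolding \<Phi>_def by blast
  qed
  ultimately have "|B| \<le>o |Pow (T \<times> T)|" by (rule card_of_ordLeqI)
  then show ?thesis using Pow by (rule ordLeq_ordLess_trans)
qed

section \<open>Countable models in a FUR-class and the resulting bound\<close>

lemma (in fur_class) monster_in_K: "M \<in> K"
  using monster_model by (simp add: monster_def)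

lemma (in fur_class) countable_model_over:
  assumes "finite A" "A \<subseteq> univ M"
  obtains X where "is_model \<tau> le \<delta> M X" "countable X" "A \<subseteq> X"
proof -
  have "ls_bound \<tau> le K natLeq" using LS_omega by (simp add: ls_number_def)
  then have "\<forall>C\<in>K. \<forall>X\<subseteq>univ C. \<exists>B. B \<preceq> C \<and> X \<subseteq> univ B \<and> |univ B| \<le>o |X| +c natLeq"
    by (simp add: ls_bound_def)
  then obtain B where B: "B \<preceq> M" "A \<subseteq> univ B" "|univ B| \<le>o |A| +c natLeq"
    using monster_in_K assms(2) by blast
  have "|A| +c natLeq \<le>o natLeq"
    using assms(1) by (simp add: csum_def Field_card_of countable_finite flip: countable_card_le_natLeq)
  with B(3) have le: "|univ B| \<le>o natLeq" by (rule ordLeq_transitive)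
  have sB: "is_struct \<tau> B" and sub: "substruct \<tau> B M"
    using structs le_in[OF B(1)] le_substruct[OF B(1)] by auto
  \<comment> \<open>Models are represented by their universes, so \<open>B\<close> has to be
    recovered from \<open>univ B\<close>. Equality, and not just isomorphism, holds because
    \<open>is_struct\<close> normalises the values off the universe and off the vocabulary.\<close>
  have "induced \<tau> M (univ B) = B"
  proof (rule lstruct.equality)
    show "fun_of (induced \<tau> M (univ B)) = fun_of B"
    proof (intro ext)
      fix s xs
      show "fun_of (induced \<tau> M (univ B)) s xs = fun_of B s xs"
      proof (cases "s \<in> fsyms \<tau> \<and> xs \<in> tuples (univ B) (farity \<tau> s)")
        case True
        then show ?thesis using sub by (simp add: induced_def substruct_def)
      next
        case False
        then have "fun_of B s xs = undefined" using sB unfolding is_struct_def by metis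
        with False show ?thesis by (auto simp: induced_def)
      qed
    qed
    show "rel_of (induced \<tau> M (univ B)) = rel_of B"
    proof
      fix s
      have "rel_of B s \<subseteq> (if s \<in> rsyms \<tau> then tuples (univ B) (rarity \<tau> s) else {})"
        using sB unfolding is_struct_def by blast
      then show "rel_of (induced \<tau> M (univ B)) s = rel_of B s"
        using sub by (auto simp: induced_def substruct_def split: if_splits)
    qed
  qed (simp_all add: induced_def)
  moreover have "|univ B| <o \<delta>"
    using le large_cardinal by (auto simp: inaccessible_def intro: ordLeq_ordLess_trans)
  ultimately have "is_model \<tau> le \<delta> M (univ B)"
    using B(1) sub by (simp add: is_model_def substruct_def)
  then show ?thesis using that B(2) le by (simp add: countable_card_le_natLeq)
qed

text \<open>By (AI) the countable model around \<open>A\<close> is s-saturated, so the preceding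
  count applies.\<close>

lemma (in fur_class) lascar_rels_bound:
  assumes "finite A" "A \<subseteq> univ M"
  shows "|\<Union>n. lascar_rels \<tau> \<delta> M A n| <o \<delta>"
proof -
  obtain X where X: "is_model \<tau> le \<delta> M X" "countable X" "A \<subseteq> X"
    using countable_model_over[OF assms] .
  show ?thesis
    using large_cardinal structs[OF monster_in_K] X(2) _ _ X(3) assms(1)
  proof (rule countable_lascar_bound)
    show "X \<subseteq> univ M" using X(1) by (simp add: is_model_def)
    show "s_saturated \<tau> M X" using AI X(1,2) by simp
  qed
qed

section \<open>Automorphisms of the structure of imaginaries\<close>

lemma real_elem_inj: "inj_on (real_elem M) (univ M)"
  by (auto simp: inj_on_def real_elem_def cls_def equality_rel_def tuples_def)

lemma real_elem_map_inj:
  "inj_on (map (real_elem M)) (lists (univ M))"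
  using real_elem_inj[of M] by (intro inj_on_mapI) (auto elim: inj_on_subset)

lemma real_elem_in_univ:
  assumes "equality_rel M \<in> \<E>" "x \<in> univ M"
  shows "real_elem M x \<in> univ (eq_struct \<tau> M \<E>)"
proof -
  have "[x] \<in> Domain (equality_rel M)" using assms(2) by (simp add: equality_rel_def tuples_def)
  then show ?thesis using assms(1) unfolding eq_struct_def real_elem_def by auto
qed

text \<open>The sort of equality consists exactly of the real elements, so \<open>f\<close> permutes
  them. The symbols \<open>Graph\<close> and \<open>Rel\<close> make the induced permutation respect
  the functions and relations of \<open>M\<close>.\<close>

lemma Aut_eq_struct_induced:
  assumes M: "is_struct \<tau> M" and eq: "equality_rel M \<in> \<E>"
    and f: "f \<in> Aut (eq_vocab \<tau> \<E>) (eq_struct \<tau> M \<E>)"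
  obtains f0 where "f0 \<in> Aut \<tau> M" "\<And>x. x \<in> univ M \<Longrightarrow> f (real_elem M x) = real_elem M (f0 x)"
proof -
  let ?N = "eq_struct \<tau> M \<E>" and ?r = "real_elem M"
  have rel: "xs \<in> rel_of ?N s \<longleftrightarrow> map f xs \<in> rel_of ?N s"
    if "s \<in> rsyms (eq_vocab \<tau> \<E>)" "xs \<in> lists (univ ?N)" "length xs = rarity (eq_vocab \<tau> \<E>) s" for s xs
    using f that by (auto simp: Aut_def iso_def tuples_def)
  have sort: "rel_of ?N (Sort (equality_rel M)) = {[?r x] |x. x \<in> univ M}"
  proof -
    have "Domain (equality_rel M) = {[x] |x. x \<in> univ M}"
      by (auto simp: equality_rel_def tuples_def length_Suc_conv)
    then show ?thesis using eq by (auto simp: eq_struct_def real_elem_def)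
  qed
  have real_iff: "z \<in> ?r ` univ M \<longleftrightarrow> f z \<in> ?r ` univ M" if "z \<in> univ ?N" for z
    using rel[of "Sort (equality_rel M)" "[z]"] that eq unfolding sort
    by (auto simp: eq_vocab_def)
  have univ: "?r x \<in> univ ?N" if "x \<in> univ M" for x
    using real_elem_in_univ[OF eq that] .
  have "f (?r x) \<in> ?r ` univ M" if "x \<in> univ M" for x
    using real_iff[OF univ[OF that]] that by simp
  then have "\<forall>x\<in>univ M. \<exists>y\<in>univ M. f (?r x) = ?r y" by blast
  then obtain f0 where f0: "\<And>x. x \<in> univ M \<Longrightarrow> f0 x \<in> univ M"
    "\<And>x. x \<in> univ M \<Longrightarrow> f (?r x) = ?r (f0 x)"
    by metis
  have map_f: "map f (map ?r xs) = map ?r (map f0 xs)" if "xs \<in> lists (univ M)" for xs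
    using that f0 by auto
  have map_f0: "map f0 xs \<in> lists (univ M)" if "xs \<in> lists (univ M)" for xs
    using that f0 by auto
  have "inj_on f0 (univ M)"
  proof (rule inj_onI)
    fix x y assume xy: "x \<in> univ M" "y \<in> univ M" "f0 x = f0 y"
    then have "f (?r x) = f (?r y)" using f0(2) by simp
    then have "?r x = ?r y" using inj_onD[OF AutD(1)[OF f] _ univ univ] xy by simp
    then show "x = y" by (rule inj_onD[OF real_elem_inj _ xy(1,2)])
  qed
  moreover have "f0 ` univ M = univ M"
  proof
    show "univ M \<subseteq> f0 ` univ M"
    proof
      fix y assume y: "y \<in> univ M"
      have "?r y \<in> f ` univ ?N" using univ[OF y] unfolding AutD(2)[OF f] .
      then obtain z where z: "z \<in> univ ?N" "f z = ?r y" by auto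
      \<comment> \<open>Sorts are preserved in both directions, so the preimage of a real element is
        again real; this makes \<open>f0\<close> surjective.\<close>
      have "z \<in> ?r ` univ M" using real_iff[OF z(1)] y unfolding z(2) by simp
      then obtain x where x: "x \<in> univ M" "z = ?r x" by blast
      then have "?r y = ?r (f0 x)" using z(2) f0(2) by simp
      then have "y = f0 x" using inj_onD[OF real_elem_inj _ y f0(1)[OF x(1)]] by simp
      then show "y \<in> f0 ` univ M" using x(1) by simp
    qed
  qed (use f0 in auto)
  ultimately have "bij_betw f0 (univ M) (univ M)" by (simp add: bij_betw_def)
  moreover have "f0 (fun_of M s xs) = fun_of M s (map f0 xs)"
    if s: "s \<in> fsyms \<tau>" and xs: "xs \<in> tuples (univ M) (farity \<tau> s)" for s xs
  proof -
    let ?xs = "xs @ [fun_of M s xs]"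
    have G: "rel_of ?N (Graph s) =
        {map ?r (xs @ [fun_of M s xs]) |xs. xs \<in> tuples (univ M) (farity \<tau> s)}"
      using s by (simp add: eq_struct_def)
    have xsM: "?xs \<in> lists (univ M)"
      using xs is_struct_closed[OF M s xs] by (auto simp: tuples_def)
    have "map ?r ?xs \<in> rel_of ?N (Graph s)" unfolding G using xs by blast
    moreover have "map ?r ?xs \<in> lists (univ ?N)" using xsM univ by auto
    ultimately have "map f (map ?r ?xs) \<in> rel_of ?N (Graph s)"
      using rel[of "Graph s" "map ?r ?xs"] s xs by (simp add: eq_vocab_def tuples_def)
    \<comment> \<open>The image of a graph tuple is a graph tuple over some \<open>ys\<close>.
      Comparing initial segments gives \<open>ys = map f0 xs\<close>, and comparing last entries
      gives preservation of the function.\<close>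
    then obtain ys where ys: "ys \<in> tuples (univ M) (farity \<tau> s)"
      "map ?r (map f0 ?xs) = map ?r (ys @ [fun_of M s ys])"
      unfolding map_f[OF xsM] G by blast
    have "ys @ [fun_of M s ys] \<in> lists (univ M)"
      using ys(1) is_struct_closed[OF M s ys(1)] by (auto simp: tuples_def)
    then have "map f0 ?xs = ys @ [fun_of M s ys]"
      by (rule inj_onD[OF real_elem_map_inj ys(2) map_f0[OF xsM]])
    then show ?thesis by auto
  qed
  moreover have "xs \<in> rel_of M s \<longleftrightarrow> map f0 xs \<in> rel_of M s"
    if s: "s \<in> rsyms \<tau>" and xs: "xs \<in> tuples (univ M) (rarity \<tau> s)" for s xs
  proof -
    have R: "rel_of ?N (Rel s) = map ?r ` rel_of M s" using s by (simp add: eq_struct_def)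
    have "rel_of M s \<subseteq> (if s \<in> rsyms \<tau> then tuples (univ M) (rarity \<tau> s) else {})"
      using M unfolding is_struct_def by blast
    then have relM: "rel_of M s \<subseteq> lists (univ M)" using s by (auto simp: tuples_def)
    have xsM: "xs \<in> lists (univ M)" using xs by (simp add: tuples_def)
    have iff: "map ?r ys \<in> rel_of ?N (Rel s) \<longleftrightarrow> ys \<in> rel_of M s" if "ys \<in> lists (univ M)" for ys
      unfolding R by (rule inj_on_image_mem_iff[OF real_elem_map_inj that relM])
    have "map ?r xs \<in> lists (univ ?N)" using xsM univ by auto
    then have "map ?r xs \<in> rel_of ?N (Rel s) \<longleftrightarrow> map ?r (map f0 xs) \<in> rel_of ?N (Rel s)"
      using rel[of "Rel s" "map ?r xs"] s xs unfolding map_f[OF xsM]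
      by (simp add: eq_vocab_def tuples_def)
    then show ?thesis using iff[OF xsM] iff[OF map_f0[OF xsM]] by simp
  qed
  ultimately have "f0 \<in> Aut \<tau> M" by (auto simp: Aut_def iso_def)
  then show ?thesis using that f0(2) by blast
qed

section \<open>Invariance of the global type\<close>

text \<open>Independence yields a non-splitting realization \<open>b'\<close> over any small
  \<open>D\<close>; for \<open>D = B \<union> C\<close> it has the type of \<open>b\<close> over all
  of \<open>D\<close>, so non-splitting passes to \<open>b\<close> itself.\<close>

lemma indep_not_lascar_splits:
  assumes N: "is_struct \<tau> N" and b: "b \<in> lists (univ N)" and D: "B \<union> C \<subseteq> univ N" "|B \<union> C| <o \<kappa>"
    and indep: "indep \<tau> \<delta> \<kappa> N b B C"
  obtains A where "A \<subseteq> B" "finite A" "\<not> lascar_splits \<tau> \<delta> N b (B \<union> C) A"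
proof -
  obtain A b' where A: "A \<subseteq> B" "finite A" and b': "b' \<in> lists (univ N)" "same_tp \<tau> N (B \<union> C) b' b"
    and ns: "\<not> lascar_splits \<tau> \<delta> N b' (B \<union> C) A"
    using indep D unfolding indep_def by (metis order_refl)
  have AN: "A \<subseteq> univ N" using A D by blast
  have "same_tp \<tau> N A (b @ c) (b @ d)"
    if c: "c \<in> lists (B \<union> C)" and d: "d \<in> lists (B \<union> C)" and Lt: "same_Lt \<tau> \<delta> N A c d" for c d
  proof -
    have gtp: "same_gtp \<tau> N A (b' @ e) (b @ e)" if "e \<in> lists (B \<union> C)" for e
    proof -
      \<comment> \<open>Weak types control only finite bases, and \<open>A\<close> together with the
        entries of \<open>e\<close> is one.\<close>
      have "A \<union> set e \<subseteq> B \<union> C" "finite (A \<union> set e)" using that A by auto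
      then have "same_gtp \<tau> N (A \<union> set e) b' b" using b'(2) unfolding same_tp_def by blast
      then obtain h where "h \<in> AutOver \<tau> N (A \<union> set e)" "map h b' = b"
        by (auto simp: same_gtp_def)
      then show ?thesis by (rule same_gtp_append_fixed)
    qed
    have "same_gtp \<tau> N A (b @ c) (b' @ c)"
      by (rule same_gtp_sym[OF N AN _ gtp[OF c]]) (use b'(1) c D(1) in auto)
    moreover have "same_gtp \<tau> N A (b' @ c) (b' @ d)"
      using ns c d Lt unfolding lascar_splits_def same_tp_finite[OF A(2)] by blast
    ultimately show ?thesis
      unfolding same_tp_finite[OF A(2)] using gtp[OF d] by (blast intro: same_gtp_trans)
  qed
  then have "\<not> lascar_splits \<tau> \<delta> N b (B \<union> C) A" unfolding lascar_splits_def by blast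
  then show ?thesis using that A by blast
qed

text \<open>If \<open>k\<close> fixes all classes of the bounded relations over \<open>A\<close>,
  then \<open>c\<close> and \<open>map k c\<close> have the same Lascar type over \<open>A0\<close>,
  and non-splitting makes \<open>b @ c\<close> and \<open>b @ map k c\<close> conjugate. Hence the
  type of \<open>b\<close> over a finite set is carried by \<open>k\<close> to the type of
  \<open>b\<close> over its image.\<close>

lemma fixes_type_if_lascar_trivial:
  assumes M': "is_struct \<tau> M'" and sub: "univ M \<subseteq> univ M'" and A: "A \<subseteq> univ M"
    and ext: "\<And>f. f \<in> Aut \<tau> M \<Longrightarrow> \<exists>g\<in>Aut \<tau> M'. \<forall>x\<in>univ M. g x = f x"
    and b: "b \<in> lists (univ M')" and ns: "\<not> lascar_splits \<tau> \<delta> M' b (univ M) A0" "A0 \<subseteq> A" "finite A0"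
    and k: "k \<in> Aut \<tau> M" "\<And>x. x \<in> univ M \<Longrightarrow> f (real_elem M x) = real_elem M (k x)"
    and triv: "\<And>n E c. E \<in> lascar_rels \<tau> \<delta> M A n \<Longrightarrow> c \<in> tuples (univ M) n \<Longrightarrow> (c, map k c) \<in> E"
  shows "fixes_type M f (tp_over_monster \<tau> M' b)"
proof -
  have Lt: "same_Lt \<tau> \<delta> M' A0 c (map k c)" if c: "c \<in> lists (univ M)" for c
  proof -
    have "(c, map k c) \<in> E" if E: "E \<in> lascar_rels \<tau> \<delta> M' A1 (length c)" "A1 \<subseteq> A0" for E A1
    proof -
      have "E \<in> lascar_rels \<tau> \<delta> M' A (length c)"
        using E lascar_rels_mono[of A1 A] ns(2) by blast
      then have "E \<inter> tuples (univ M) (length c) \<times> tuples (univ M) (length c) \<in> lascar_rels \<tau> \<delta> M A (length c)"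
        using sub A ext by (rule lascar_rels_restrict)
      from triv[OF this] show ?thesis using c by (auto simp: tuples_def)
    qed
    then show ?thesis by (simp add: same_Lt_def)
  qed
  have moved: "same_gtp \<tau> M' {} (b @ c) (b @ map k c)" if c: "c \<in> lists (univ M)" for c
  proof -
    have "same_tp \<tau> M' A0 (b @ c) (b @ map k c)"
      using ns(1) Lt[OF c] c Aut_lists[OF k(1) c] unfolding lascar_splits_def by blast
    then show ?thesis by (simp add: same_tp_def)
  qed
  have "same_gtp \<tau> M' A1 b x'"
    if AB: "A1 \<subseteq> univ M" "B \<subseteq> univ M" "finite B" "f ` real_elem M ` B = real_elem M ` A1"
      and x: "x \<in> lists (univ M)" "x' \<in> lists (univ M)" "same_gtp \<tau> M' B b x"
        "map f (map (real_elem M) x) = map (real_elem M) x'" for A1 B x x'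
  proof -
    have "map (real_elem M) (map k x) = map (real_elem M) x'"
      unfolding x(4)[symmetric] using x(1) k(2) by auto
    then have x': "map k x = x'"
      using inj_onD[OF real_elem_map_inj[of M]] x(2) Aut_lists[OF k(1) x(1)] by blast
    have "real_elem M ` k ` B = real_elem M ` A1"
      using AB(2,4) k(2) by (force simp: image_image subset_iff)
    moreover have "k ` B \<subseteq> univ M" using AB(2) Aut_in_univ[OF k(1)] by blast
    ultimately have A1: "A1 = k ` B"
      using inj_on_image_eq_iff[OF real_elem_inj[of M]] AB(1) by metis
    obtain c where c: "set c = B" using finite_list[OF AB(3)] by blast
    have cM: "c \<in> lists (univ M)" using c AB(2) by auto
    \<comment> \<open>Types are computed in \<open>M'\<close>, hence the extension \<open>g\<close>
      of \<open>k\<close>. The chain of conjugate tuples below is \<open>b @ map k c\<close>,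
      \<open>b @ c\<close>, \<open>x @ c\<close>, \<open>x' @ map k c\<close>.\<close>
    obtain g where g: "g \<in> Aut \<tau> M'" "\<forall>y\<in>univ M. g y = k y" using ext[OF k(1)] by blast
    obtain h where h: "h \<in> AutOver \<tau> M' B" "map h b = x" using x(3) by (auto simp: same_gtp_def)
    have "same_gtp \<tau> M' {} (b @ map k c) (b @ c)"
      by (rule same_gtp_sym[OF M' _ _ moved[OF cM]]) (use b cM sub in auto)
    moreover have "same_gtp \<tau> M' {} (b @ c) (x @ c)"
      using h c by (auto intro: same_gtp_append_fixed)
    moreover have "map g (x @ c) = x' @ map k c"
      using g(2) x' x(1) cM by auto
    then have "same_gtp \<tau> M' {} (x @ c) (x' @ map k c)"
      using g(1) unfolding same_gtp_def AutOver_empty by blast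
    ultimately have "same_gtp \<tau> M' {} (b @ map k c) (x' @ map k c)"
      using same_gtp_trans by blast
    moreover have "length b = length x'" using h(2) x' by auto
    ultimately have "same_gtp \<tau> M' (set (map k c)) b x'" by (rule same_gtp_over_set)
    then show ?thesis using A1 c by simp
  qed
  then show ?thesis using sub by (auto simp: fixes_type_def tp_over_monster_def gtp_def)
qed

section \<open>Counting the conjugates of the canonical base\<close>

theorem lemma2p79:
  fixes \<tau> :: "('f, 'r) vocab"
    and le :: "('u, 'f, 'r) lstruct \<Rightarrow> ('u, 'f, 'r) lstruct \<Rightarrow> bool"
    and K :: "('u, 'f, 'r) lstruct set"
    and \<delta> :: "'c rel"
    and M M' :: "('u, 'f, 'r) lstruct"
    and \<E> :: "('u list \<times> 'u list) set set"
    and a :: "'u list" and A :: "'u set" and \<alpha> :: "'u imag list"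
  assumes "fur_class \<tau> le K \<delta> M"
    and "supermonster \<tau> le K M M'"
    and "imaginaries \<tau> M M' \<E>"
    and "a \<in> lists (univ M)"
    and "A \<subseteq> univ M" and "finite A"
    and "is_Cb \<tau> \<delta> M M' \<E> a A \<alpha>"
  shows "\<alpha> \<in> bcl (eq_vocab \<tau> \<E>) \<delta> (eq_struct \<tau> M \<E>) (real_elem M ` A)"
proof -
  interpret fur_class \<tau> le K \<delta> M by fact
  interpret imaginaries \<tau> M M' \<E> by fact
  let ?N = "eq_struct \<tau> M \<E>" and ?v = "eq_vocab \<tau> \<E>" and ?r = "real_elem M"
  have le: "le M M'" and card: "|univ M| <o |univ M'|"
    using assms(2) by (auto simp: supermonster_def)
  have M: "is_struct \<tau> M" and M': "is_struct \<tau> M'" and sub: "univ M \<subseteq> univ M'"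
    using le le_in structs le_substruct by (auto simp: substruct_def)
  \<comment> \<open>Since \<open>M\<close> is smaller than \<open>M'\<close>, it counts as a small
    submodel, and model homogeneity of \<open>M'\<close> extends its automorphisms.\<close>
  have ext: "\<exists>g\<in>Aut \<tau> M'. \<forall>x\<in>univ M. g x = f x" if "f \<in> Aut \<tau> M" for f
    using assms(2) that le card unfolding supermonster_def monster_def Aut_def by blast
  obtain b where b: "b \<in> lists (univ M')" "indep \<tau> \<delta> |univ M'| M' b A (univ M)"
    and cb: "canonical_base \<tau> M M' \<E> (tp_over_monster \<tau> M' b) \<alpha>"
    using assms(7) by (auto simp: is_Cb_def)
  have AM: "A \<union> univ M = univ M" using assms(5) by blast
  obtain A0 where A0: "A0 \<subseteq> A" "finite A0" "\<not> lascar_splits \<tau> \<delta> M' b (univ M) A0"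
    using indep_not_lascar_splits[OF M' b(1) _ _ b(2)] sub card unfolding AM by metis
  have \<alpha>: "\<alpha> \<in> lists (univ ?N)" using cb by (simp add: canonical_base_def)
  define B where "B = {\<beta> \<in> lists (univ ?N). same_tp ?v ?N (?r ` A) \<beta> \<alpha>}"
  define lifts where "lifts \<beta> f f0 \<longleftrightarrow> f \<in> Aut ?v ?N \<and> map f \<beta> = \<alpha> \<and> f0 \<in> AutOver \<tau> M A \<and>
      (\<forall>x\<in>univ M. f (?r x) = ?r (f0 x))" for \<beta> f f0
  have "\<exists>f f0. lifts \<beta> f f0" if "\<beta> \<in> B" for \<beta>
  proof -
    obtain f where f: "f \<in> AutOver ?v ?N (?r ` A)" "map f \<beta> = \<alpha>"
      using \<open>\<beta> \<in> B\<close> assms(6) by (auto simp: B_def same_tp_finite same_gtp_def)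
    then have fA: "f \<in> Aut ?v ?N" "\<And>x. x \<in> A \<Longrightarrow> f (?r x) = ?r x" by (auto simp: AutOver_def)
    obtain f0 where f0: "f0 \<in> Aut \<tau> M" "\<And>x. x \<in> univ M \<Longrightarrow> f (?r x) = ?r (f0 x)"
      using Aut_eq_struct_induced[OF M equality fA(1)] by blast
    have "f0 x = x" if "x \<in> A" for x
    proof (rule inj_onD[OF real_elem_inj])
      show x: "x \<in> univ M" using that assms(5) by blast
      then show "f0 x \<in> univ M" by (rule Aut_in_univ[OF f0(1)])
      show "?r (f0 x) = ?r x" using f0(2)[OF x] fA(2)[OF that] by simp
    qed
    then have "lifts \<beta> f f0" using f f0 fA by (simp add: lifts_def AutOver_def)
    then show ?thesis by blast
  qed
  then obtain F F0 where "\<And>\<beta>. \<beta> \<in> B \<Longrightarrow> lifts \<beta> (F \<beta>) (F0 \<beta>)" by metis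
  then have F: "\<And>\<beta>. \<beta> \<in> B \<Longrightarrow> F \<beta> \<in> Aut ?v ?N" "\<And>\<beta>. \<beta> \<in> B \<Longrightarrow> map (F \<beta>) \<beta> = \<alpha>"
    and F0: "\<And>\<beta>. \<beta> \<in> B \<Longrightarrow> F0 \<beta> \<in> AutOver \<tau> M A"
      "\<And>\<beta> x. \<beta> \<in> B \<Longrightarrow> x \<in> univ M \<Longrightarrow> F \<beta> (?r x) = ?r (F0 \<beta> x)"
    by (simp_all add: lifts_def)
  have "|B| <o \<delta>"
  proof (rule inj_action_bound[OF large_cardinal lascar_rels_bound[OF assms(6,5)], of _ F0])
    show "F0 \<beta> \<in> AutOver \<tau> M A" if "\<beta> \<in> B" for \<beta> using F0(1)[OF that] .
  next
    fix \<beta> \<gamma>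
    assume B: "\<beta> \<in> B" "\<gamma> \<in> B"
      and same: "\<And>n E c. E \<in> lascar_rels \<tau> \<delta> M A n \<Longrightarrow> c \<in> tuples (univ M) n \<Longrightarrow>
        (map (F0 \<beta>) c, map (F0 \<gamma>) c) \<in> E"
    have "fun_of ?N s xs \<in> univ ?N" if "s \<in> fsyms ?v" for s xs
      using that by (simp add: eq_vocab_def)
    then obtain g where g: "g \<in> Aut ?v ?N" "\<And>z. z \<in> univ ?N \<Longrightarrow> g (F \<beta> z) = z"
      "\<And>z. z \<in> univ ?N \<Longrightarrow> F \<beta> (g z) = z"
      using Aut_inverse[OF F(1)[OF B(1)]] by blast
    obtain g0 where g0: "g0 \<in> Aut \<tau> M" "\<And>x. x \<in> univ M \<Longrightarrow> g (?r x) = ?r (g0 x)"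
      using Aut_eq_struct_induced[OF M equality g(1)] by blast
    have F0A: "F0 \<beta> \<in> Aut \<tau> M" "F0 \<gamma> \<in> Aut \<tau> M" using F0(1) B by (auto simp: AutOver_def)
    have Fg0: "F0 \<beta> (g0 x) = x" if "x \<in> univ M" for x
    proof -
      have "g0 x \<in> univ M" using Aut_in_univ[OF g0(1) that] .
      then have "?r (F0 \<beta> (g0 x)) = ?r x"
        using F0(2)[OF B(1)] g0(2)[OF that] g(3)[OF real_elem_in_univ[OF equality that]] by simp
      then show ?thesis
        by (rule inj_onD[OF real_elem_inj _ Aut_in_univ[OF F0A(1) \<open>g0 x \<in> univ M\<close>] that])
    qed
    \<comment> \<open>The composite sends \<open>\<alpha>\<close> through \<open>\<beta>\<close> to
      \<open>map (F \<gamma>) \<beta>\<close>. If it fixes the type, it fixes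
      \<open>\<alpha>\<close>, which is also \<open>map (F \<gamma>) \<gamma>\<close>; injectivity
      of \<open>F \<gamma>\<close> then gives \<open>\<beta> = \<gamma>\<close>.\<close>
    have "fixes_type M (F \<gamma> \<circ> g) (tp_over_monster \<tau> M' b)"
    proof (rule fixes_type_if_lascar_trivial[where k = "F0 \<gamma> \<circ> g0"])
      show "F0 \<gamma> \<circ> g0 \<in> Aut \<tau> M" using Aut_comp[OF g0(1) F0A(2)] .
      show "(F \<gamma> \<circ> g) (?r x) = ?r ((F0 \<gamma> \<circ> g0) x)" if "x \<in> univ M" for x
        using that g0(2) F0(2)[OF B(2)] Aut_in_univ[OF g0(1)] by simp
      show "(c, map (F0 \<gamma> \<circ> g0) c) \<in> E"
        if E: "E \<in> lascar_rels \<tau> \<delta> M A n" and c: "c \<in> tuples (univ M) n" for n E c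
      proof -
        \<comment> \<open>Agreement of the two actions is used at \<open>map g0 c\<close>, which
          \<open>F0 \<beta>\<close> returns to \<open>c\<close>.\<close>
        have "map (F0 \<beta>) (map g0 c) = c"
          using c Fg0 by (auto simp: tuples_def intro!: map_idI)
        then show ?thesis using same[OF E Aut_tuples[OF g0(1) c]] by simp
      qed
    qed (use M' sub assms(5) ext b A0 in auto)
    then have "map (F \<gamma> \<circ> g) \<alpha> = \<alpha>"
      using cb Aut_comp[OF g(1) F(1)[OF B(2)]] by (auto simp: canonical_base_def)
    moreover have "map g \<alpha> = \<beta>"
      using F(2)[OF B(1)] g(2) B(1) by (auto simp: B_def intro!: map_idI)
    ultimately have "map (F \<gamma>) \<beta> = map (F \<gamma>) \<gamma>" using F(2)[OF B(2)] by (metis map_map)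
    moreover have "inj_on (map (F \<gamma>)) (lists (univ ?N))"
      using AutD(1)[OF F(1)[OF B(2)]] by (intro inj_on_mapI) (auto elim: inj_on_subset)
    ultimately show "\<beta> = \<gamma>" using B by (auto simp: B_def dest: inj_onD)
  qed
  then show ?thesis using \<alpha> by (simp add: bcl_def B_def)
qed

end
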